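(* Let $a>0$, $x>0$, $0<\theta,\psi<1$, let $k\geq 0$ be an even integer, and let $\nu\in\mathbb{C}$ with $\Re(\nu)>0$. Then \begin{align*} &\left(\frac{a^2x}{4}\right)^{\frac{\nu}{2}+k+1}\sum_{n=1}^{\infty} n^{\nu/2}K_{\nu}(a\sqrt{nx})\sum_{d\mid n}d^k\sin(2\pi d\theta)\cos\left(\frac{2\pi n\psi}{d}\right)\\ &=-\frac{(-1)^{k/2}a^{2k+2}k!}{2^{2k+4}(2\pi)^{k+1}}\Gamma(\nu)\bigl(\zeta(1+k,\theta)-\zeta(1+k,1-\theta)\bigr)x^{k+1}\\ &\quad+\frac{(-1)^{k/2}(2\pi)^{k+1}}{8}\Gamma(\nu+k+1)\sum_{m,n\geq 0}\left\{\frac{(n+\psi)^k}{\left(\frac{16\pi^2}{a^2}\frac{(n+\psi)(m+\theta)}{x}+1\right)^{\nu+k+1}}+\frac{(n+1-\psi)^k}{\left(\frac{16\pi^2}{a^2}\frac{(n+1-\psi)(m+\theta)}{x}+1\right)^{\nu+k+1}}\right.\\ &\qquad\left.-\frac{(n+1-\psi)^k}{\left(\frac{16\pi^2}{a^2}\frac{(n+1-\psi)(m+1-\theta)}{x}+1\right)^{\nu+k+1}}-\frac{(n+\psi)^k}{\left(\frac{16\pi^2}{a^2}\frac{(n+\psi)(m+1-\theta)}{x}+1\right)^{\nu+k+1}}\right\}. \end{align*}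
   Context: $K_\nu$ denotes the modified Bessel function of the second kind of order $\nu$. $\zeta(s,\alpha)=\sum_{n=0}^\infty (n+\alpha)^{-s}$ ($\Re s>1$) is the Hurwitz zeta function; when $k=0$ the expression $\zeta(1,\theta)-\zeta(1,1-\theta)$ is understood as $\lim_{s\to1}(\zeta(s,\theta)-\zeta(s,1-\theta))$. The double sum runs over all pairs of non-negative integers $m,n$. *)

theory Defs
  imports "HOL-Analysis.Analysis"
begin

definition besselK :: "complex \<Rightarrow> real \<Rightarrow> complex" where
  "besselK \<nu> z = integral {0..} (\<lambda>t::real. complex_of_real (exp (- z * cosh t)) * cosh (\<nu> * complex_of_real t))"

definition hurwitz_zeta :: "real \<Rightarrow> real \<Rightarrow> real" where
  "hurwitz_zeta s \<alpha> = (\<Sum>n. (real n + \<alpha>) powr (- s))"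

definition hurwitz_zeta_diff :: "real \<Rightarrow> real \<Rightarrow> real" where
  "hurwitz_zeta_diff s \<theta> =
     (if s = 1 then Lim (at_right 1) (\<lambda>r. hurwitz_zeta r \<theta> - hurwitz_zeta r (1 - \<theta>))
      else hurwitz_zeta s \<theta> - hurwitz_zeta s (1 - \<theta>))"

end

(*
  Since (n X)^(nu/2) K_nu(2 sqrt(n X)) is half the integral over t > 0 of t^(nu-1) exp(-t - n X/t),
  the left-hand side is a Mellin-type integral of the Lambert series
    F(u) = SUM_e cos(2 pi e psi) SUM_d d^k sin(2 pi d theta) exp(-d e u)   at u = X/t, X = a^2 x/4.
  The function g(y) = y^k sinh(v y (1/2 - theta)) / sinh(v y/2) is even. For v = 4 pi^2/u its e-th Fourier
  coefficient is, by the partial fraction expansion of the cotangent and its derivatives, a multiple of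
  the e-th inner sum of F, and its 0-th one is a multiple of zeta(1+k,theta) - zeta(1+k,1-theta).
  Poisson summation of g over the integers shifted by psi therefore expresses F(X/t) through the double
  series of (n+psi)^k exp(-v (n+psi)(m+theta)) and its three reflections, and integrating against
  t^(nu-1) exp(-t) termwise with the Gamma integral gives the right-hand side. Poisson summation only
  needs that a continuous function with vanishing cosine coefficients is zero.
*)
theory Submission
  imports Defs
begin

subsection \<open>Poisson summation for cosine series\<close>

text \<open>For k = 0 the partial-fraction series over \<open>m + \<theta>\<close> and
  \<open>m + (1 - \<theta>)\<close> diverge separately. So the two stay together in the kernel, and
  its termwise cosine transform needs an argument of its own: at fixed \<open>\<theta>\<close> all
  differences have the same sign, which reduces absolute convergence to frequency 0. Only after
  Poisson summation, where the exponentials decay in both indices, is the kernel split into four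
  double series; against t^(nu+k) exp(-t) each converges absolutely because Re nu > 0.

  Evenness of k makes g even, so its values on the half line suffice, and makes (-2 pi i)^k real, so
  a real part isolates the sine series. The cosine coefficients are explicit and absolutely
  summable; this takes the place of smoothness in the Poisson formula.

  Solving that formula for F multiplies the double series by v^(k+1) = (4 pi^2 t/X)^(k+1) and leaves
  the zeta term free of v. Hence Gamma(nu+k+1) beside the double series, whose power of X cancels
  the prefactor X^(k+1), and Gamma(nu) beside the zeta term, where that prefactor survives as
  a^(2k+2) x^(k+1).\<close>

lemma uniform_series_continuous_integral:
  fixes f :: "nat \<Rightarrow> real \<Rightarrow> real"
  assumes cont: "\<And>n. continuous_on {a..b} (f n)"
    and bound: "\<And>n x. x \<in> {a..b} \<Longrightarrow> \<bar>f n x\<bar> \<le> M n" and M: "summable M"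
  shows "continuous_on {a..b} (\<lambda>x. \<Sum>n. f n x)"
    and "(\<lambda>n. integral {a..b} (f n)) sums integral {a..b} (\<lambda>x. \<Sum>n. f n x)"
proof -
  have u: "uniform_limit {a..b} (\<lambda>n x. \<Sum>i<n. f i x) (\<lambda>x. \<Sum>n. f n x) sequentially"
    by (rule Weierstrass_m_test[OF _ M]) (use bound in auto)
  have c: "continuous_on {a..b} (\<lambda>x. \<Sum>i<n. f i x)" for n
    by (intro continuous_on_sum cont)
  show "continuous_on {a..b} (\<lambda>x. \<Sum>n. f n x)"
    by (rule uniform_limit_theorem[OF _ u]) (use c in auto)
  obtain I J where I: "\<And>n. ((\<lambda>x. \<Sum>i<n. f i x) has_integral I n) {a..b}"
    and J: "((\<lambda>x. \<Sum>n. f n x) has_integral J) {a..b}" and lim: "I \<longlonglongrightarrow> J"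
    using uniform_limit_integral[OF u c] by auto
  have "I = (\<lambda>n. \<Sum>i<n. integral {a..b} (f i))"
  proof
    show "I n = (\<Sum>i<n. integral {a..b} (f i))" for n
      using integral_unique[OF I[of n]] by (subst (asm) integral_sum) (auto intro: integrable_continuous_real cont)
  qed
  then have "(\<lambda>n. integral {a..b} (f n)) sums J"
    using lim by (simp add: sums_def)
  then show "(\<lambda>n. integral {a..b} (f n)) sums integral {a..b} (\<lambda>x. \<Sum>n. f n x)"
    using J by (simp add: integral_unique)
qed

text \<open>Products of cosines reduce to sums of cosines, so \<open>h\<close> is orthogonal to
  every polynomial in cos(2 pi x). Approximating \<open>h\<close> itself by such polynomials makes
  the integral of h^2 arbitrarily small, and continuity gives h = 0.\<close>

lemma cosine_coefficients_unique:
  fixes h :: "real \<Rightarrow> real"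
  assumes cont: "continuous_on {0..1} h"
    and sym: "\<And>x. x \<in> {0..1} \<Longrightarrow> h (1 - x) = h x"
    and coef: "\<And>e::nat. integral {0..1} (\<lambda>x. h x * cos (2 * pi * real e * x)) = 0"
    and x: "x \<in> {0..1}"
  shows "h x = 0"
proof -
  note [continuous_intros] = cont
  \<comment> \<open>Multiplication by cos(2 pi x) moves the frequency to its neighbours
    \<open>e + 1\<close> and \<open>e - 1\<close>, hence the induction on \<open>j\<close> with
    \<open>e\<close> arbitrary; at \<open>e = 0\<close> both neighbours amount to frequency
    1.\<close>
  have coef': "integral {0..1} (\<lambda>x. h x * (cos (2 * pi * x) ^ j * cos (2 * pi * real e * x))) = 0" for j e :: nat
  proof (induction j arbitrary: e)
    case 0
    then show ?case using coef by simp
  next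
    case (Suc j)
    show ?case
    proof (cases e)
      case 0
      then show ?thesis using Suc.IH[of 1] by (simp add: mult_ac)
    next
      case (Suc e')
      have "cos (2 * pi * x) * cos (2 * pi * real e * x) =
          cos (2 * pi * real (Suc e) * x) / 2 + cos (2 * pi * real e' * x) / 2" for x :: real
        using cos_times_cos[of "2 * pi * real e * x" "2 * pi * x"] Suc
        by (simp add: algebra_simps add_divide_distrib)
      then have eq: "h x * (cos (2 * pi * x) ^ Suc j * cos (2 * pi * real e * x)) =
         h x * (cos (2 * pi * x) ^ j * cos (2 * pi * real (Suc e) * x)) / 2
         + h x * (cos (2 * pi * x) ^ j * cos (2 * pi * real e' * x)) / 2" for x
        unfolding power_Suc2 mult.assoc by (simp only: distrib_left times_divide_eq_right)
      show ?thesis unfolding eq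
        by (subst integral_add)
           (auto intro!: integrable_continuous_real continuous_intros simp: Suc.IH simp del: of_nat_Suc)
    qed
  qed
  have poly: "integral {0..1} (\<lambda>x. h x * (\<Sum>i\<le>n. c i * cos (2 * pi * x) ^ i)) = 0" for n c
  proof -
    have "integral {0..1} (\<lambda>x. h x * (\<Sum>i\<le>n. c i * cos (2 * pi * x) ^ i)) =
        integral {0..1} (\<lambda>x. \<Sum>i\<le>n. c i * (h x * cos (2 * pi * x) ^ i))"
      by (simp add: sum_distrib_left mult_ac)
    also have "\<dots> = (\<Sum>i\<le>n. integral {0..1} (\<lambda>x. c i * (h x * cos (2 * pi * x) ^ i)))"
      by (rule integral_sum) (auto intro!: integrable_continuous_real continuous_intros)
    also have "\<dots> = 0" using coef'[of _ 0] by simp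
    finally show ?thesis .
  qed
  txt \<open>By symmetry \<open>h\<close> is a continuous function of \<open>cos (2 \<pi> x)\<close>, so the algebraic Weierstrass theorem applies.\<close>
  define H where "H c = h (arccos c / (2 * pi))" for c
  have "0 \<le> arccos c \<and> arccos c \<le> 2 * pi" if "c \<in> {-1..1}" for c
    using arccos_lbound[of c] arccos_ubound[of c] that pi_gt_zero by auto
  then have H: "continuous_on {-1..1} H"
    unfolding H_def
    by (intro continuous_on_compose2[OF cont]) (auto intro!: continuous_intros simp: divide_simps)
  have Hcos: "H (cos (2 * pi * x)) = h x" if "x \<in> {0..1}" for x
  proof (cases "x \<le> 1/2")
    case True
    then show ?thesis using that by (simp add: H_def arccos_cos)
  next
    case False
    have "cos (2 * pi * x) = cos (2 * pi * (1 - x))"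
      by (simp add: algebra_simps cos_diff)
    then have "H (cos (2 * pi * x)) = h (1 - x)"
      using False that by (simp add: H_def arccos_cos)
    then show ?thesis using sym that by simp
  qed
  define J where "J = integral {0..1} (\<lambda>x. \<bar>h x\<bar>)"
  have J: "J \<ge> 0" unfolding J_def by (rule integral_nonneg) (auto intro!: integrable_continuous_real continuous_intros)
  have small: "integral {0..1} (\<lambda>x. h x * h x) \<le> \<epsilon> * J" if e: "\<epsilon> > 0" for \<epsilon>
  proof -
    obtain p where p: "real_polynomial_function p" and pH: "\<And>c. c \<in> {-1..1} \<Longrightarrow> \<bar>H c - p c\<bar> < \<epsilon>"
      using Stone_Weierstrass_real_polynomial_function[OF _ H e] by auto
    obtain c n where pc: "p = (\<lambda>x. \<Sum>i\<le>n. c i * x ^ i)"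
      using p by (auto simp: real_polynomial_function_iff_sum)
    have contp: "continuous_on {0..1} (\<lambda>x. p (cos (2 * pi * x)))"
      unfolding pc by (intro continuous_intros)
    \<comment> \<open>The subtracted integral is 0 by \<open>poly\<close>; what remains is h (h -
      p), where |h - p| is at most \<open>\<epsilon>\<close> everywhere.\<close>
    have "integral {0..1} (\<lambda>x. h x * h x) = integral {0..1} (\<lambda>x. h x * h x) - integral {0..1} (\<lambda>x. h x * p (cos (2 * pi * x)))"
      using poly by (simp add: pc)
    also have "\<dots> = integral {0..1} (\<lambda>x. h x * (h x - p (cos (2 * pi * x))))"
      by (subst integral_diff[symmetric], (intro integrable_continuous_real continuous_intros contp)+)
         (simp add: right_diff_distrib)
    also have "\<dots> \<le> integral {0..1} (\<lambda>x. \<epsilon> * \<bar>h x\<bar>)"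
    proof (rule integral_le)
      fix x :: real assume x: "x \<in> {0..1}"
      have "\<bar>h x - p (cos (2 * pi * x))\<bar> \<le> \<epsilon>"
        using pH[of "cos (2 * pi * x)"] Hcos[OF x] by simp
      then have "\<bar>h x\<bar> * \<bar>h x - p (cos (2 * pi * x))\<bar> \<le> \<bar>h x\<bar> * \<epsilon>"
        by (rule mult_left_mono) simp
      then show "h x * (h x - p (cos (2 * pi * x))) \<le> \<epsilon> * \<bar>h x\<bar>"
        by (simp add: abs_mult[symmetric] mult.commute abs_le_iff)
    qed (auto intro!: integrable_continuous_real continuous_intros contp)
    also have "\<dots> = \<epsilon> * J" by (simp add: J_def)
    finally show ?thesis .
  qed
  have "integral {0..1} (\<lambda>x. h x * h x) \<le> \<epsilon>" if "\<epsilon> > 0" for \<epsilon>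
  proof -
    \<comment> \<open>The \<open>+ 1\<close> keeps the divisor positive when \<open>J\<close> is
      0.\<close>
    have "integral {0..1} (\<lambda>x. h x * h x) \<le> \<epsilon> / (J + 1) * J"
      using small[of "\<epsilon> / (J + 1)"] that J by auto
    also have "\<dots> \<le> \<epsilon>" using that J by (simp add: field_simps)
    finally show ?thesis .
  qed
  then have "integral {0..1} (\<lambda>x. h x * h x) \<le> 0"
    by (rule field_le_epsilon) simp
  moreover have "integral {0..1} (\<lambda>x. h x * h x) \<ge> 0"
    by (rule integral_nonneg) (auto intro!: integrable_continuous_real continuous_intros)
  ultimately have "integral {0..1} (\<lambda>x. h x * h x) = 0" by simp
  then have "\<forall>x\<in>{0..1}. h x * h x = 0"
    by (subst (asm) integral_eq_0_iff) (auto intro!: continuous_intros)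
  with x show ?thesis by auto
qed

text \<open>Writing one frequency as \<open>Suc i\<close> keeps it positive, so the sum of the
  frequencies never vanishes and the diagonal value is always 1/2. The constant term of the cosine
  series is treated apart.\<close>

lemma integral_cos_cos:
  fixes i j :: nat
  shows "integral {0..1} (\<lambda>x. cos (2 * pi * real (Suc i) * x) * cos (2 * pi * real j * x)) = (if Suc i = j then 1/2 else 0)"
proof -
  have c: "((\<lambda>x. cos (2 * pi * of_int n * x)) has_integral (if n = 0 then 1 else 0)) {0..1}" for n :: int
  proof (cases "n = 0")
    case True
    then show ?thesis using has_integral_const_real[of "1::real" 0 1] by simp
  next
    case False
    have "((\<lambda>x. cos (2 * pi * of_int n * x)) has_integral
        (sin (2 * pi * of_int n * 1) / (2 * pi * of_int n) - sin (2 * pi * of_int n * 0) / (2 * pi * of_int n))) {0..1}"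
      using False
      by (intro fundamental_theorem_of_calculus)
         (auto intro!: derivative_eq_intros simp flip: has_real_derivative_iff_has_vector_derivative)
    then show ?thesis using False by (simp add: sin_int_2pin)
  qed
  have "(\<lambda>x::real. cos (2 * pi * real (Suc i) * x) * cos (2 * pi * real j * x)) =
     (\<lambda>x. cos (2 * pi * of_int (int j - int (Suc i)) * x) / 2 + cos (2 * pi * of_int (int (Suc i) + int j) * x) / 2)"
    by (simp add: cos_times_cos algebra_simps add_divide_distrib)
  moreover have "(\<dots> has_integral ((if int j - int (Suc i) = 0 then 1 else 0) / 2 + (if int (Suc i) + int j = 0 then 1 else 0) / 2)) {0..1}"
    by (intro has_integral_add has_integral_divide c)
  ultimately show ?thesis by (simp add: integral_unique)
qed

lemma cos_nat_reflect: "cos (2 * pi * real e * (1 - x)) = cos (2 * pi * real e * x)"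
proof -
  have "cos (2 * pi * real e * (1 - x)) = cos (2 * real e * pi - 2 * pi * real e * x)"
    by (simp add: algebra_simps)
  then show ?thesis unfolding cos_diff cos_2npi sin_2npi by simp
qed

text \<open>Here \<open>g\<close> stands for the restriction of an even function, so the terms at
  \<open>n + x\<close> and \<open>n + 1 - x\<close> together run over the shifted integers. As
  \<open>b e\<close> is half a Fourier coefficient of the even extension, frequency 0 gets weight 2,
  and e paired with -e gets weight 4. Both sides are continuous in \<open>x\<close> by the M-test
  and have equal cosine coefficients.\<close>

lemma poisson_summation_cos:
  fixes g :: "real \<Rightarrow> real" and b :: "nat \<Rightarrow> real"
  assumes cont: "continuous_on {0..} g"
    and bound: "\<And>n y. real n \<le> y \<Longrightarrow> y \<le> real n + 1 \<Longrightarrow> \<bar>g y\<bar> \<le> M n" and M: "summable M"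
    and b: "\<And>e. (\<lambda>N. integral {0..real N} (\<lambda>y. g y * cos (2 * pi * real e * y))) \<longlonglongrightarrow> b e"
    and b_summable: "summable (\<lambda>e. \<bar>b e\<bar>)"
    and x: "x \<in> {0..1}"
  shows "(\<Sum>n. g (real n + x) + g (real n + 1 - x)) = 2 * b 0 + 4 * (\<Sum>e. b (Suc e) * cos (2 * pi * real (Suc e) * x))"
proof -
  note c = continuous_on_compose2[OF cont]
  define P where "P x = (\<Sum>n. g (real n + x) + g (real n + 1 - x))" for x
  define Q where "Q x = (\<Sum>e. b (Suc e) * cos (2 * pi * real (Suc e) * x))" for x
  have cf: "continuous_on {0..1} (\<lambda>x. (g (real n + x) + g (real n + 1 - x)) * cos (2 * pi * real e * x))" for n e
    by (intro continuous_intros c) auto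
  have M2: "summable (\<lambda>n. 2 * M n)" using M by (rule summable_mult)
  have Mb: "\<bar>g (real n + x) + g (real n + 1 - x)\<bar> \<le> 2 * M n" if "x \<in> {0..1}" for n x
    using bound[of n "real n + x"] bound[of n "real n + 1 - x"] that by auto
  have Mb': "\<bar>(g (real n + x) + g (real n + 1 - x)) * cos (2 * pi * real e * x)\<bar> \<le> 2 * M n" if "x \<in> {0..1}" for n x e
  proof -
    have "\<bar>(g (real n + x) + g (real n + 1 - x)) * cos (2 * pi * real e * x)\<bar> \<le> \<bar>g (real n + x) + g (real n + 1 - x)\<bar> * 1"
      unfolding abs_mult by (rule mult_left_mono) auto
    then show ?thesis using Mb[OF that, of n] by simp
  qed
  have sumP: "summable (\<lambda>n. g (real n + x) + g (real n + 1 - x))" if "x \<in> {0..1}" for x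
    by (rule summable_comparison_test[OF _ M2]) (use Mb[OF that] in auto)
  have Pc: "continuous_on {0..1} P"
    unfolding P_def using uniform_series_continuous_integral(1)[OF cf[of _ 0] _ M2] Mb by simp
  \<comment> \<open>Integer shifts and the reflection x to 1 - x leave cos(2 pi e x) unchanged, so
    both terms of the \<open>n\<close>-th summand contribute the integral over [n, n+1]; hence the
    factor 2.\<close>
  have PI: "integral {0..1} (\<lambda>x. P x * cos (2 * pi * real e * x)) = 2 * b e" for e
  proof -
    let ?G = "\<lambda>y. g y * cos (2 * pi * real e * y)"
    have Gi: "?G integrable_on {real n..real m}" for n m
      by (intro integrable_continuous_real continuous_intros c) auto
    have 1: "((\<lambda>x. g (real n + x) * cos (2 * pi * real e * x)) has_integral integral {real n..real n + 1} ?G) {0..1}" for n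
    proof -
      have "((?G \<circ> (+) (real n)) has_integral integral {real n..real n + 1} ?G) {0..1}"
        unfolding has_integral_shift_Icc_real using integrable_integral[OF Gi[of n "n + 1"]] by (simp add: add.commute)
      moreover have "cos (2 * pi * real e * (real n + x)) = cos (2 * pi * real e * x)" for x
      proof -
        have "cos (2 * pi * real e * (real n + x)) = cos (2 * pi * real e * x + 2 * real (e * n) * pi)"
          by (simp add: algebra_simps)
        then show ?thesis unfolding cos_add sin_2npi cos_2npi by simp
      qed
      ultimately show ?thesis by (simp add: o_def)
    qed
    have 2: "((\<lambda>x. g (real n + 1 - x) * cos (2 * pi * real e * x)) has_integral integral {real n..real n + 1} ?G) {0..1}" for n
    proof -
      have "((\<lambda>x. g (real n + (1 - x)) * cos (2 * pi * real e * (1 - x))) has_integral integral {real n..real n + 1} ?G) {0..1}"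
        using has_integral_affinity[OF 1[of n, folded cbox_interval], of "-1" 1] by (simp add: algebra_simps image_affinity_atLeastAtMost_diff)
      moreover have "cos (2 * pi * real e * (1 - x)) = cos (2 * pi * real e * x)" for x
        using cos_nat_reflect by simp
      ultimately show ?thesis by (simp add: add_diff_eq)
    qed
    have 3: "integral {0..1} (\<lambda>x. (g (real n + x) + g (real n + 1 - x)) * cos (2 * pi * real e * x)) = 2 * integral {real n..real n + 1} ?G" for n
      using integral_unique[OF has_integral_add[OF 1 2]] by (simp add: distrib_right)
    have 4: "(\<Sum>n<N. integral {real n..real n + 1} ?G) = integral {0..real N} ?G" for N
    proof (induction N)
      case (Suc N)
      then show ?case using Gi[of 0 "Suc N"]
        by (simp add: Henstock_Kurzweil_Integration.integral_combine add.commute)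
    qed simp
    have "(\<lambda>n. integral {real n..real n + 1} ?G) sums b e"
      using b[of e] by (simp add: sums_def 4)
    then have "(\<lambda>n. 2 * integral {real n..real n + 1} ?G) sums (2 * b e)" by (rule sums_mult)
    moreover have "(\<lambda>n. 2 * integral {real n..real n + 1} ?G) sums integral {0..1} (\<lambda>x. \<Sum>n. (g (real n + x) + g (real n + 1 - x)) * cos (2 * pi * real e * x))"
      using uniform_series_continuous_integral(2)[OF cf[of _ e] _ M2] Mb' 3 by simp
    ultimately have "2 * b e = integral {0..1} (\<lambda>x. \<Sum>n. (g (real n + x) + g (real n + 1 - x)) * cos (2 * pi * real e * x))"
      by (rule sums_unique2)
    also have "\<dots> = integral {0..1} (\<lambda>x. P x * cos (2 * pi * real e * x))"
      unfolding P_def by (rule integral_cong) (simp add: suminf_mult2[OF sumP])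
    finally show ?thesis by simp
  qed
  have bS: "summable (\<lambda>e. \<bar>b (Suc e)\<bar>)" using b_summable by (subst summable_Suc_iff)
  have cq: "continuous_on {0..1} (\<lambda>x. b (Suc i) * cos (2 * pi * real (Suc i) * x) * cos (2 * pi * real e * x))" for i e
    by (intro continuous_intros)
  have qb: "\<bar>b (Suc i) * cos (2 * pi * real (Suc i) * x) * cos (2 * pi * real e * x)\<bar> \<le> \<bar>b (Suc i)\<bar>" for i e x
    unfolding abs_mult mult.assoc by (intro mult_left_le mult_le_one) auto
  have sumQ: "summable (\<lambda>e. b (Suc e) * cos (2 * pi * real (Suc e) * x))" for x
    by (rule summable_comparison_test[OF _ bS]) (use qb[of _ _ 0] in auto)
  have Qc: "continuous_on {0..1} Q"
    unfolding Q_def using uniform_series_continuous_integral(1)[OF cq[of _ 0] qb bS] by simp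
  \<comment> \<open>The 1/2 from orthogonality turns the weight 4 of \<open>Q\<close> into the 2 b e
    found for \<open>P\<close>. At e = 0 the series contributes nothing, and the constant 2 b 0 does
    the work.\<close>
  have QI: "integral {0..1} (\<lambda>x. Q x * cos (2 * pi * real e * x)) = (if e = 0 then 0 else b e / 2)" for e
  proof -
    have "(\<lambda>i. integral {0..1} (\<lambda>x. b (Suc i) * cos (2 * pi * real (Suc i) * x) * cos (2 * pi * real e * x)))
        sums integral {0..1} (\<lambda>x. \<Sum>i. b (Suc i) * cos (2 * pi * real (Suc i) * x) * cos (2 * pi * real e * x))"
      by (rule uniform_series_continuous_integral(2)[OF cq qb bS])
    also have "(\<lambda>i. integral {0..1} (\<lambda>x. b (Suc i) * cos (2 * pi * real (Suc i) * x) * cos (2 * pi * real e * x)))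
        = (\<lambda>i. if Suc i = e then b e / 2 else 0)"
    proof
      fix i
      show "integral {0..1} (\<lambda>x. b (Suc i) * cos (2 * pi * real (Suc i) * x) * cos (2 * pi * real e * x)) = (if Suc i = e then b e / 2 else 0)"
        by (simp only: mult.assoc[of "b (Suc i)"] integral_mult_right integral_cos_cos) auto
    qed
    also have "(\<lambda>x. \<Sum>i. b (Suc i) * cos (2 * pi * real (Suc i) * x) * cos (2 * pi * real e * x)) = (\<lambda>x. Q x * cos (2 * pi * real e * x))"
      unfolding Q_def by (intro ext suminf_mult2[OF sumQ, symmetric])
    finally have "(\<lambda>i. if Suc i = e then b e / 2 else 0) sums integral {0..1} (\<lambda>x. Q x * cos (2 * pi * real e * x))" .
    moreover have "(\<lambda>i. if Suc i = e then b e / 2 else 0) sums (if e = 0 then 0 else b e / 2)"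
      using sums_single[of "e - 1" "\<lambda>_. b e / 2"] by (cases e) auto
    ultimately show ?thesis using sums_unique2 by blast
  qed
  have "P x - (2 * b 0 + 4 * Q x) = 0"
  proof (rule cosine_coefficients_unique[where h = "\<lambda>x. P x - (2 * b 0 + 4 * Q x)", OF _ _ _ x])
    show "continuous_on {0..1} (\<lambda>x. P x - (2 * b 0 + 4 * Q x))"
      by (intro continuous_intros Pc Qc)
    show "P (1 - x) - (2 * b 0 + 4 * Q (1 - x)) = P x - (2 * b 0 + 4 * Q x)" for x
    proof -
      have "Q (1 - x) = Q x" by (simp only: Q_def cos_nat_reflect)
      moreover have "P (1 - x) = P x"
        unfolding P_def by (intro suminf_cong) (simp add: algebra_simps)
      ultimately show ?thesis by simp
    qed
    fix e
    have "integral {0..1} (\<lambda>x. (P x - (2 * b 0 + 4 * Q x)) * cos (2 * pi * real e * x)) =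
      integral {0..1} (\<lambda>x. P x * cos (2 * pi * real e * x)) - (2 * b 0 * integral {0..1} (\<lambda>x. cos (2 * pi * real e * x))
        + 4 * integral {0..1} (\<lambda>x. Q x * cos (2 * pi * real e * x)))"
    proof -
      have "((\<lambda>x. P x * cos (2 * pi * real e * x) - (2 * b 0 * cos (2 * pi * real e * x) + 4 * (Q x * cos (2 * pi * real e * x))))
        has_integral integral {0..1} (\<lambda>x. P x * cos (2 * pi * real e * x)) - (2 * b 0 * integral {0..1} (\<lambda>x. cos (2 * pi * real e * x))
          + 4 * integral {0..1} (\<lambda>x. Q x * cos (2 * pi * real e * x)))) {0..1}"
        by (intro has_integral_diff has_integral_add has_integral_mult_right integrable_integral
            integrable_continuous_real continuous_intros Pc Qc)
      then show ?thesis
        by (intro integral_unique) (simp add: algebra_simps)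
    qed
    also have "integral {0..1} (\<lambda>x. cos (2 * pi * real e * x)) = (if e = 0 then 1 else 0)"
      using integral_cos_cos[of "e - 1" 0] by (cases e) auto
    finally show "integral {0..1} (\<lambda>x. (P x - (2 * b 0 + 4 * Q x)) * cos (2 * pi * real e * x)) = 0"
      by (simp add: PI QI)
  qed
  then show ?thesis unfolding P_def Q_def by simp
qed

subsection \<open>Partial fractions of the cotangent\<close>

text \<open>Termwise differentiation keeps convergence inside the unit disc and brings down a factor
  n, which raises the exponent \<open>k\<close> by one.\<close>

lemma summable_of_nat_power_times_power:
  fixes x :: "'a :: {real_normed_field, banach}"
  assumes "norm x < 1"
  shows "summable (\<lambda>n. of_nat n ^ k * x ^ n)"
  using assms
proof (induction k arbitrary: x)
  case 0
  then show ?case by (simp add: summable_geometric)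
next
  case (Suc k)
  have "summable (\<lambda>n. diffs (\<lambda>n. of_nat n ^ k) n * x ^ n)"
    by (rule termdiff_converges[OF Suc.prems]) (use Suc.IH in auto)
  then have "summable (\<lambda>n. x * (diffs (\<lambda>n. of_nat n ^ k) n * x ^ n))"
    by (rule summable_mult)
  then have "summable (\<lambda>n. of_nat (Suc n) ^ Suc k * x ^ Suc n)"
    by (simp add: diffs_def mult_ac)
  then show ?case by (subst (asm) summable_Suc_iff)
qed

text \<open>This is the logarithmic derivative of Gamma(z) Gamma(1-z) = pi/sin(pi z), obtained by
  differentiating both sides and dividing by the product, so no branch of a logarithm
  enters.\<close>

lemma Digamma_reflection:
  fixes z :: complex
  assumes "z \<notin> \<int>"
  shows "Digamma (1 - z) - Digamma z = of_real pi * cos (of_real pi * z) / sin (of_real pi * z)"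
proof -
  have open_ni: "open (- \<int> :: complex set)" by (simp add: open_Compl)
  have z: "z \<notin> \<int>\<^sub>\<le>\<^sub>0" "1 - z \<notin> \<int>\<^sub>\<le>\<^sub>0"
    using assms nonpos_Ints_subset_Ints by (auto dest: nonpos_Ints_Int)
  have sin0: "sin (of_real pi * z) \<noteq> 0"
    using assms by (auto simp: sin_eq_0 mult.commute)
  have "((\<lambda>z. Gamma z * Gamma (1 - z)) has_field_derivative
      Gamma z * Digamma z * Gamma (1 - z) + (Gamma (1 - z) * Digamma (1 - z) * (-1)) * Gamma z) (at z)"
    by (rule derivative_eq_intros refl z | simp)+
  then have "((\<lambda>z. of_real pi / sin (of_real pi * z)) has_field_derivative
      Gamma z * Digamma z * Gamma (1 - z) + (Gamma (1 - z) * Digamma (1 - z) * (-1)) * Gamma z) (at z)"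
    by (simp add: Gamma_reflection_complex)
  moreover have "((\<lambda>z. of_real pi / sin (of_real pi * z)) has_field_derivative
      - (of_real pi * (cos (of_real pi * z) * of_real pi)) / (sin (of_real pi * z) * sin (of_real pi * z))) (at z)"
    using sin0 by (auto intro!: derivative_eq_intros)
  ultimately have "Gamma z * Digamma z * Gamma (1 - z) + (Gamma (1 - z) * Digamma (1 - z) * (-1)) * Gamma z
     = - (of_real pi * (cos (of_real pi * z) * of_real pi)) / (sin (of_real pi * z) * sin (of_real pi * z))"
    by (rule DERIV_unique)
  then have "(Gamma z * Gamma (1 - z)) * (Digamma (1 - z) - Digamma z)
     = (of_real pi / sin (of_real pi * z)) * (of_real pi * cos (of_real pi * z) / sin (of_real pi * z))"
    by (simp add: algebra_simps)
  then have "(of_real pi / sin (of_real pi * z)) * (Digamma (1 - z) - Digamma z)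
     = (of_real pi / sin (of_real pi * z)) * (of_real pi * cos (of_real pi * z) / sin (of_real pi * z))"
    by (simp only: Gamma_reflection_complex)
  then show ?thesis
    by (rule mult_left_cancel[THEN iffD1, rotated]) (use sin0 in simp)
qed

text \<open>In the lower half plane q = exp(-2 pi i z) has norm below 1, and pi cot(pi z) = pi i
  (1+q)/(1-q) expands geometrically in q. Each differentiation brings down -2 pi i d, flips the sign
  of the polygamma at \<open>1 - z\<close>, and kills the constant pi i, which is therefore present
  only for k = 0. This is the Lipschitz summation formula.\<close>

lemma Polygamma_reflection_lower_half_plane:
  fixes z :: complex
  assumes "Im z < 0"
  shows "(-1) ^ k * Polygamma k (1 - z) - Polygamma k z =
     (if k = 0 then of_real pi * \<i> else 0) +
     2 * of_real pi * \<i> * (\<Sum>d. (- 2 * of_real pi * \<i> * of_nat (Suc d)) ^ k * exp (- 2 * of_real pi * \<i> * z) ^ Suc d)"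
  using assms
proof (induction k arbitrary: z)
  case 0
  define q where "q = exp (- 2 * of_real pi * \<i> * z)"
  have q: "norm q < 1" using 0 by (simp add: q_def mult_pos_neg)
  then have q1: "q \<noteq> 1" by auto
  have "z \<notin> \<int>" using 0 by (auto elim!: Ints_cases)
  note Digamma_reflection[OF this]
  also have "of_real pi * cos (of_real pi * z) / sin (of_real pi * z) = of_real pi * \<i> * (1 + q) / (1 - q)"
  proof -
    define E where "E = exp (\<i> * (of_real pi * z))"
    have E: "E \<noteq> 0" by (simp add: E_def)
    have "q = inverse (E * E)"
      by (simp add: q_def E_def exp_minus[symmetric] exp_add[symmetric] algebra_simps)
    moreover have cs: "cos (of_real pi * z) = (E + inverse E) / 2" "sin (of_real pi * z) = (E - inverse E) / (2 * \<i>)"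
      by (simp_all add: cos_exp_eq sin_exp_eq E_def exp_minus)
    moreover have "E * E \<noteq> 1" using calculation(1) q1 by (metis inverse_1)
    ultimately show ?thesis
      unfolding cs using E q1 by (simp add: divide_simps) (simp add: algebra_simps)
  qed
  also have "\<dots> = of_real pi * \<i> + 2 * of_real pi * \<i> * (q / (1 - q))"
  proof -
    have "(1 + q) / (1 - q) = 1 + 2 * (q / (1 - q))" using q1 by (simp add: divide_simps)
    then show ?thesis
      unfolding times_divide_eq_right[of _ "1 + q", symmetric] by (simp only: distrib_left mult_1_right mult_1_left mult_ac)
  qed
  also have "q / (1 - q) = (\<Sum>d. q ^ Suc d)"
    using suminf_mult[OF summable_geometric[OF q], of q] suminf_geometric[OF q] by simp
  finally show ?case by (simp add: q_def)
next
  case (Suc k)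
  define p where "p = (- 2 * of_real pi * \<i> :: complex)"
  \<comment> \<open>The coefficient at n = 0 is forced to be 0: for k = 0 the power would be 0^0 = 1
    and add a constant term to the series.\<close>
  define c where "c n = (if n = 0 then 0 else (p * of_nat n) ^ k)" for n
  define F where "F q = (\<Sum>n. c n * q ^ n)" for q
  have sc: "summable (\<lambda>n. c n * q ^ n)" if "norm q < 1" for q
  proof -
    have "summable (\<lambda>n. p ^ k * (of_nat n ^ k * q ^ n))"
      by (intro summable_mult summable_of_nat_power_times_power that)
    then have "summable (\<lambda>n. (p * of_nat n) ^ k * q ^ n)"
      by (simp add: power_mult_distrib mult_ac)
    then have "summable (\<lambda>n. (p * of_nat (Suc n)) ^ k * q ^ (Suc n))"
      by (rule summable_Suc_iff[THEN iffD2])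
    then have "summable (\<lambda>n. c (Suc n) * q ^ (Suc n))" by (simp only: c_def if_False nat.simps)
    then show ?thesis by (rule summable_Suc_iff[THEN iffD1])
  qed
  have FS: "F q = (\<Sum>d. (p * of_nat (Suc d)) ^ k * q ^ Suc d)" if "norm q < 1" for q
    using suminf_split_head[OF sc[OF that]] by (simp add: F_def c_def)
  have nq: "norm (exp (p * z)) < 1" if "Im z < 0" for z
    using that by (simp add: p_def mult_pos_neg)
  define q where "q = exp (p * z)"
  have q: "norm q < 1" using nq Suc.prems by (simp add: q_def)
  obtain K where K: "norm q < K" "K < 1" using dense q by blast
  then have "0 \<le> K" using norm_ge_zero[of q] by linarith
  then have "DERIV F q :> (\<Sum>n. diffs c n * q ^ n)"
    unfolding F_def using K by (intro termdiffs_strong[of c "of_real K"] sc) auto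
  then have "DERIV F (exp (p * z)) :> (\<Sum>n. diffs c n * q ^ n)" by (simp add: q_def)
  then have DF: "((\<lambda>z. F (exp (p * z))) has_field_derivative (\<Sum>n. diffs c n * q ^ n) * (q * p)) (at z)"
    by (rule DERIV_chain2) (auto intro!: derivative_eq_intros simp: q_def)
  have nn: "z \<notin> \<int>\<^sub>\<le>\<^sub>0" "1 - z \<notin> \<int>\<^sub>\<le>\<^sub>0"
    using Suc.prems by (auto elim!: nonpos_Ints_cases simp: complex_eq_iff)
  have "((\<lambda>z. (-1) ^ k * Polygamma k (1 - z) - Polygamma k z) has_field_derivative
     (-1) ^ k * (Polygamma (Suc k) (1 - z) * (-1)) - Polygamma (Suc k) z) (at z)"
    by (rule derivative_eq_intros refl nn | simp)+
  \<comment> \<open>The induction hypothesis holds on the whole open half plane, so it may be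
    differentiated; uniqueness of the derivative then gives the next case.\<close>
  moreover have "((\<lambda>z. (-1) ^ k * Polygamma k (1 - z) - Polygamma k z) has_field_derivative
     2 * of_real pi * \<i> * ((\<Sum>n. diffs c n * q ^ n) * (q * p))) (at z)"
  proof (rule has_field_derivative_transform_within_open)
    show "((\<lambda>z. (if k = 0 then of_real pi * \<i> else 0) + 2 * of_real pi * \<i> * F (exp (p * z))) has_field_derivative
        2 * of_real pi * \<i> * ((\<Sum>n. diffs c n * q ^ n) * (q * p))) (at z)"
      by (rule derivative_eq_intros DF refl | simp)+
    show "open {z. Im z < 0}" by (rule open_halfspace_Im_lt)
    show "z \<in> {z. Im z < 0}" using Suc.prems by simp
    show "(if k = 0 then of_real pi * \<i> else 0) + 2 * of_real pi * \<i> * F (exp (p * w)) = (-1) ^ k * Polygamma k (1 - w) - Polygamma k w"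
      if "w \<in> {z. Im z < 0}" for w
      using Suc.IH[of w] that FS[OF nq[of w]] by (simp add: p_def)
  qed
  ultimately have "(-1) ^ k * (Polygamma (Suc k) (1 - z) * (-1)) - Polygamma (Suc k) z =
     2 * of_real pi * \<i> * ((\<Sum>n. diffs c n * q ^ n) * (q * p))"
    by (rule DERIV_unique)
  also have "(\<Sum>n. diffs c n * q ^ n) * (q * p) = (\<Sum>d. (p * of_nat (Suc d)) ^ Suc k * q ^ Suc d)"
  proof -
    have "summable (\<lambda>n. diffs c n * q ^ n)"
      by (rule termdiff_converges[OF q]) (use sc in auto)
    then have "(\<Sum>n. diffs c n * q ^ n) * (q * p) = (\<Sum>n. diffs c n * q ^ n * (q * p))"
      by (rule suminf_mult2)
    then show ?thesis by (simp add: diffs_def c_def mult_ac)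
  qed
  finally show ?case by (simp add: p_def q_def)
qed

text \<open>For \<open>k = 0\<close> the two halves of the series diverge separately.\<close>
lemma sums_Polygamma_diff:
  fixes z :: "'a :: {real_normed_field, banach}"
  assumes "z \<noteq> 0" "z \<noteq> 1" "even k"
  shows "(\<lambda>m. 1 / (of_nat m + z) ^ Suc k - 1 / (of_nat m + (1 - z)) ^ Suc k) sums
     ((Polygamma k (1 - z) - Polygamma k z) / fact k)"
proof (cases "k = 0")
  case True
  have "(\<lambda>n. inverse (of_nat (Suc n)) - inverse (w + of_nat n)) sums (Digamma w + euler_mascheroni)" if "w \<noteq> 0" for w :: 'a
    using summable_sums[OF summable_Digamma[OF that]] by (simp add: Digamma_def)
  from sums_diff[OF this[of "1 - z"] this[of z]] assms True
  show ?thesis by (simp add: inverse_eq_divide add_ac)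
next
  case False
  then have "(\<lambda>m. inverse ((w + of_nat m) ^ Suc k)) sums (- Polygamma k w / fact k)" if "w \<noteq> 0" for w :: 'a
    using Polygamma_LIMSEQ[OF that, of k] assms by (simp add: uminus_power_if)
  from sums_diff[OF this[of z] this[of "1 - z"]] assms
  show ?thesis by (simp add: inverse_eq_divide add_ac diff_divide_distrib)
qed

text \<open>For even \<open>k\<close> the factor (-2 pi i)^k is the real number (2 pi)^k (-1)^(k/2).
  The real part therefore drops the constant pi i and turns 2 pi i times the q-series into minus 2
  pi times its imaginary part; since the imaginary part of q^d is -sin(2 pi d theta) exp(-2 pi d
  eta), the two signs cancel.\<close>

lemma Re_sums_Lambert:
  fixes \<theta> \<eta> :: real
  assumes "even k" "\<eta> > 0"
  defines "z \<equiv> Complex \<theta> (- \<eta>)"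
  shows "(\<lambda>m. Re (1 / (of_nat m + z) ^ Suc k - 1 / (of_nat m + (1 - z)) ^ Suc k)) sums
     ((2 * pi) ^ (k + 1) * (-1) ^ (k div 2) / fact k *
       (\<Sum>d. real (Suc d) ^ k * sin (2 * pi * real (Suc d) * \<theta>) * exp (- (2 * pi * real (Suc d) * \<eta>))))"
proof -
  have Im: "Im z < 0" using assms by simp
  have z: "z \<noteq> 0" "z \<noteq> 1" using assms by (auto simp: complex_eq_iff)
  define q where "q = exp (- 2 * of_real pi * \<i> * z)"
  have q: "norm q < 1" using Im by (simp add: q_def mult_pos_neg)
  have ik: "(- 2 * of_real pi * \<i> :: complex) ^ k = of_real ((2 * pi) ^ k * (-1) ^ (k div 2))"
  proof -
    obtain j where j: "k = 2 * j" using assms by (elim evenE)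
    have "(- 2 * of_real pi * \<i> :: complex) ^ 2 = of_real (- ((2 * pi) ^ 2))"
      by (simp add: power2_eq_square algebra_simps)
    then have "(- 2 * of_real pi * \<i> :: complex) ^ k = of_real ((- ((2 * pi) ^ 2)) ^ j)"
      unfolding j power_mult by (simp only: of_real_power)
    also have "(- ((2 * pi) ^ 2)) ^ j = (2 * pi) ^ k * (-1) ^ (k div 2)"
      unfolding j power_mult power_minus[of "(2 * pi) ^ 2"] by simp
    finally show ?thesis .
  qed
  have S: "summable (\<lambda>d. of_nat (Suc d) ^ k * q ^ Suc d)"
    using summable_of_nat_power_times_power[OF q, of k] by (subst summable_Suc_iff)
  have ImE: "Im (of_nat (Suc d) ^ k * q ^ Suc d) =
     - (real (Suc d) ^ k * sin (2 * pi * real (Suc d) * \<theta>) * exp (- (2 * pi * real (Suc d) * \<eta>)))" for d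
  proof -
    have "q ^ Suc d = exp (of_nat (Suc d) * (- 2 * of_real pi * \<i> * z))"
      unfolding q_def exp_of_nat_mult ..
    moreover have ex: "of_nat (Suc d) * (- 2 * of_real pi * \<i> * z) =
        Complex (- (2 * pi * real (Suc d) * \<eta>)) (- (2 * pi * real (Suc d) * \<theta>))"
      by (simp add: complex_eq_iff z_def algebra_simps)
    ultimately have "Im (q ^ Suc d) = - sin (2 * pi * real (Suc d) * \<theta>) * exp (- (2 * pi * real (Suc d) * \<eta>))"
      by (simp only: ex Im_exp) simp
    then show ?thesis
      by (simp del: of_nat_Suc power_Suc flip: of_nat_power)
  qed
  have "(\<Sum>d. (- 2 * of_real pi * \<i> * of_nat (Suc d)) ^ k * q ^ Suc d) =
      of_real ((2 * pi) ^ k * (-1) ^ (k div 2)) * (\<Sum>d. of_nat (Suc d) ^ k * q ^ Suc d)"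
    unfolding power_mult_distrib[of _ "of_nat _"] ik mult.assoc[of "of_real _"] by (rule suminf_mult[OF S])
  with Polygamma_reflection_lower_half_plane[OF Im, of k] assms(1)
  have "Polygamma k (1 - z) - Polygamma k z = (if k = 0 then of_real pi * \<i> else 0) +
     2 * of_real pi * \<i> * (of_real ((2 * pi) ^ k * (-1) ^ (k div 2)) * (\<Sum>d. of_nat (Suc d) ^ k * q ^ Suc d))"
    by (simp add: q_def)
  then have "Re (Polygamma k (1 - z) - Polygamma k z) = - ((2 * pi) ^ (k + 1) * (-1) ^ (k div 2)) *
      Im (\<Sum>d. of_nat (Suc d) ^ k * q ^ Suc d)"
    by (simp add: algebra_simps)
  also have "Im (\<Sum>d. of_nat (Suc d) ^ k * q ^ Suc d) = (\<Sum>d. Im (of_nat (Suc d) ^ k * q ^ Suc d))"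
    using sums_Im[OF summable_sums[OF S]] by (simp add: sums_iff)
  also have "\<dots> = (\<Sum>d. - (real (Suc d) ^ k * sin (2 * pi * real (Suc d) * \<theta>) * exp (- (2 * pi * real (Suc d) * \<eta>))))"
    by (simp only: ImE)
  also have "\<dots> = - (\<Sum>d. real (Suc d) ^ k * sin (2 * pi * real (Suc d) * \<theta>) * exp (- (2 * pi * real (Suc d) * \<eta>)))"
    using summable_Im[OF S] unfolding ImE by (intro suminf_minus) (simp only: summable_minus_iff)
  finally have "Re (Polygamma k (1 - z) - Polygamma k z) = (2 * pi) ^ (k + 1) * (-1) ^ (k div 2) *
     (\<Sum>d. real (Suc d) ^ k * sin (2 * pi * real (Suc d) * \<theta>) * exp (- (2 * pi * real (Suc d) * \<eta>)))" by simp
  moreover have "(\<lambda>m. Re (1 / (of_nat m + z) ^ Suc k - 1 / (of_nat m + (1 - z)) ^ Suc k)) sums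
      Re ((Polygamma k (1 - z) - Polygamma k z) / fact k)"
    by (rule sums_Re[OF sums_Polygamma_diff[OF z assms(1)]])
  moreover have "Re (w / fact k) = Re w / fact k" for w
    by (metis Re_divide_of_nat of_nat_fact)
  ultimately show ?thesis by (simp only: times_divide_eq_left)
qed

subsection \<open>Cosine transform of the hyperbolic kernel\<close>

text \<open>Summability of the L1 norms allows the exchange, carried over from the Lebesgue integral
  to the gauge integral. Every exchange of a series with an integral over the half line rests on
  it.\<close>

lemma absolutely_integrable_suminf:
  fixes f :: "nat \<Rightarrow> 'a::euclidean_space \<Rightarrow> 'b::euclidean_space"
  assumes S: "S \<in> sets lebesgue" and f: "\<And>n. f n absolutely_integrable_on S"
    and summ: "\<And>x. x \<in> S \<Longrightarrow> summable (\<lambda>n. norm (f n x))"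
    and int: "summable (\<lambda>n. integral S (\<lambda>x. norm (f n x)))"
  shows "(\<lambda>x. \<Sum>n. f n x) absolutely_integrable_on S"
    and "(\<lambda>n. integral S (f n)) sums integral S (\<lambda>x. \<Sum>n. f n x)"
proof -
  have i: "integrable (lebesgue_on S) (f n)" for n
    by (rule absolutely_integrable_imp_integrable[OF f S])
  have eq: "(\<integral>x. norm (f n x) \<partial>lebesgue_on S) = integral S (\<lambda>x. norm (f n x))" for n
    by (rule lebesgue_integral_eq_integral[OF _ S]) (use i in auto)
  have ae: "AE x in lebesgue_on S. summable (\<lambda>n. norm (f n x))"
    by (rule AE_I2) (use summ in auto)
  note s = i ae int[folded eq]
  have sum_int: "integrable (lebesgue_on S) (\<lambda>x. \<Sum>n. f n x)"
    by (rule integrable_suminf[OF s])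
  then show "(\<lambda>x. \<Sum>n. f n x) absolutely_integrable_on S"
    unfolding set_integrable_def using S by (subst (asm) integrable_restrict_space) auto
  show "(\<lambda>n. integral S (f n)) sums integral S (\<lambda>x. \<Sum>n. f n x)"
    using sums_integral[OF s] by (simp add: lebesgue_integral_eq_integral[OF i S] lebesgue_integral_eq_integral[OF sum_int S])
qed

text \<open>Dominated convergence with the norm of \<open>f\<close> itself. It links the compact
  intervals of Poisson summation and of the fundamental theorem of calculus with the open half line
  of the Gamma integrals.\<close>

lemma integral_0_nat_tendsto:
  fixes f :: "real \<Rightarrow> 'a::euclidean_space"
  assumes "f absolutely_integrable_on {0<..}"
  shows "(\<lambda>N. integral {0..real N} f) \<longlonglongrightarrow> integral {0<..} f"
proof -
  let ?f = "\<lambda>N x. if x \<in> {0<..real N} then f x else 0"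
  have eq: "integral {0<..} (?f N) = integral {0..real N} f" for N
  proof -
    have "integral {0<..} (?f N) = integral ({0<..real N} \<inter> {0<..}) f"
      by (rule Henstock_Kurzweil_Integration.integral_restrict_Int)
    also have "{0<..real N} \<inter> {0<..} = {0<..real N}" by auto
    also have "integral \<dots> f = integral {0..real N} f"
      by (rule integral_spike_set) (auto intro: negligible_subset[OF negligible_sing[of 0]])
    finally show ?thesis .
  qed
  have "(\<lambda>N. integral {0<..} (?f N)) \<longlonglongrightarrow> integral {0<..} f"
  proof (rule dominated_convergence[where h = "\<lambda>x. norm (f x)"])
    show "?f N integrable_on {0<..}" for N
    proof -
      have "f integrable_on {0<..real N}"
        by (rule set_lebesgue_integral_eq_integral(1)[OF set_integrable_subset[OF assms]]) auto
      moreover have "{0<..real N} \<inter> {0<..} = {0<..real N}" by auto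
      ultimately show ?thesis by (simp only: integrable_restrict_Int)
    qed
    show "(\<lambda>x. norm (f x)) integrable_on {0<..}" using assms by (simp add: absolutely_integrable_on_def)
    show "(\<lambda>k. ?f k x) \<longlonglongrightarrow> f x" if "x \<in> {0<..}" for x
    proof (rule tendsto_eventually)
      have "eventually (\<lambda>k. real k \<ge> x) sequentially"
        using filterlim_real_sequentially unfolding filterlim_at_top by blast
      then show "eventually (\<lambda>k. ?f k x = f x) sequentially"
        by eventually_elim (use that in auto)
    qed
  qed auto
  then show ?thesis by (simp only: eq)
qed

lemma absolutely_integrable_power_exp:
  fixes s :: complex
  assumes "Re s > 0"
  shows "(\<lambda>y. of_real (y ^ k) * exp (- s * of_real y)) absolutely_integrable_on {0<..}"
proof (rule measurable_bounded_by_integrable_imp_absolutely_integrable)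
  show "(\<lambda>y. of_real (y ^ k) * exp (- s * of_real y)) \<in> borel_measurable (lebesgue_on {0<..})"
    by (intro continuous_imp_measurable_on_sets_lebesgue continuous_intros) auto
  show "(\<lambda>t. norm (complex_of_real t powr (of_nat (Suc k) - 1) / of_real (exp (Re s * t)))) integrable_on {0<..}"
    using absolutely_integrable_Gamma_integral[of "of_nat (Suc k)" "Re s"] assms
    by (simp add: absolutely_integrable_on_def)
  show "norm (of_real (y ^ k) * exp (- s * of_real y)) \<le> norm (complex_of_real y powr (of_nat (Suc k) - 1) / of_real (exp (Re s * y)))"
    if "y \<in> {0<..}" for y
    using that by (simp add: norm_mult norm_divide norm_power powr_nat' exp_minus field_simps)
qed simp

text \<open>For complex \<open>s\<close> the substitution y to s y would leave the real line, so the
  value comes from integration by parts on [0, N], by induction on \<open>k\<close>; the boundary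
  term at N vanishes in the limit by \<open>decay\<close>.\<close>

lemma integral_power_exp:
  fixes s :: complex
  assumes s: "Re s > 0"
  shows "integral {0<..} (\<lambda>y. of_real (y ^ k) * exp (- s * of_real y)) = fact k / s ^ Suc k"
proof (induction k)
  let ?E = "\<lambda>k y. of_real (y ^ k) * exp (- s * of_real y)"
  have s0: "s \<noteq> 0" using s by auto
  have decay: "(\<lambda>N. ?E k (real N)) \<longlonglongrightarrow> 0" for k
  proof (rule tendsto_norm_zero_cancel)
    have "((\<lambda>x. x ^ k / exp x) \<longlongrightarrow> (0::real)) at_top" by (rule tendsto_power_div_exp_0)
    moreover have "filterlim (\<lambda>N. Re s * real N) at_top sequentially"
      using s by (intro filterlim_tendsto_pos_mult_at_top[OF tendsto_const] filterlim_real_sequentially)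
    ultimately have "(\<lambda>N. (Re s * real N) ^ k / exp (Re s * real N)) \<longlonglongrightarrow> 0"
      by (rule filterlim_compose)
    then have "(\<lambda>N. (Re s * real N) ^ k / exp (Re s * real N) / Re s ^ k) \<longlonglongrightarrow> 0 / Re s ^ k"
      using s by (intro tendsto_divide tendsto_const) auto
    moreover have "(Re s * real N) ^ k / exp (Re s * real N) / Re s ^ k = norm (?E k (real N))" for N
      using s unfolding norm_mult norm_of_real norm_exp_eq_Re by (simp add: power_mult_distrib exp_minus divide_simps)
    ultimately show "(\<lambda>N. norm (?E k (real N))) \<longlonglongrightarrow> 0"
      by (simp only: div_0)
  qed
  have ii: "?E k integrable_on {0..real N}" for k N
    by (intro integrable_continuous_real continuous_intros)
  {
    case 0
    have "s * integral {0..real N} (?E 0) = 1 - ?E 0 (real N)" for N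
    proof -
      have "((\<lambda>y. s * ?E 0 y) has_integral (- exp (- s * of_real (real N))) - (- exp (- s * of_real 0))) {0..real N}"
        by (intro fundamental_theorem_of_calculus)
           (auto intro!: derivative_eq_intros has_vector_derivative_real_field)
      moreover have "((\<lambda>y. s * ?E 0 y) has_integral s * integral {0..real N} (?E 0)) {0..real N}"
        by (intro has_integral_mult_right integrable_integral ii)
      ultimately have "s * integral {0..real N} (?E 0) = (- exp (- s * of_real (real N))) - (- exp (- s * of_real 0))"
        by (rule has_integral_unique[symmetric])
      then show ?thesis by simp
    qed
    moreover have "(\<lambda>N. s * integral {0..real N} (?E 0)) \<longlonglongrightarrow> s * integral {0<..} (?E 0)"
      by (intro tendsto_intros integral_0_nat_tendsto absolutely_integrable_power_exp s)
    moreover have "(\<lambda>N. 1 - ?E 0 (real N)) \<longlonglongrightarrow> 1 - 0"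
      by (intro tendsto_intros decay)
    ultimately have "s * integral {0<..} (?E 0) = 1 - 0"
      using LIMSEQ_unique by simp
    then show ?case using s0 by (simp add: field_simps)
  next
    case (Suc k)
    have "s * integral {0..real N} (?E (Suc k)) = of_nat (Suc k) * integral {0..real N} (?E k) - ?E (Suc k) (real N)" for N
    proof -
      have "((\<lambda>y. s * ?E (Suc k) y - of_nat (Suc k) * ?E k y) has_integral (- ?E (Suc k) (real N)) - (- ?E (Suc k) 0)) {0..real N}"
      proof (rule fundamental_theorem_of_calculus)
        have "((\<lambda>z. - (z ^ Suc k * exp (- s * z))) has_field_derivative
            s * (z ^ Suc k * exp (- s * z)) - of_nat (Suc k) * (z ^ k * exp (- s * z))) (at z)" for z
          by (auto intro!: derivative_eq_intros simp del: power_Suc simp: algebra_simps)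
        from has_vector_derivative_real_field[OF this]
        show "((\<lambda>y. - ?E (Suc k) y) has_vector_derivative s * ?E (Suc k) y - of_nat (Suc k) * ?E k y) (at y within {0..real N})" for y
          unfolding of_real_power .
      qed simp
      moreover have "((\<lambda>y. s * ?E (Suc k) y - of_nat (Suc k) * ?E k y) has_integral
          s * integral {0..real N} (?E (Suc k)) - of_nat (Suc k) * integral {0..real N} (?E k)) {0..real N}"
        by (intro has_integral_diff has_integral_mult_right integrable_integral ii)
      ultimately have "s * integral {0..real N} (?E (Suc k)) - of_nat (Suc k) * integral {0..real N} (?E k) = (- ?E (Suc k) (real N)) - (- ?E (Suc k) 0)"
        by (rule has_integral_unique[symmetric])
      then show ?thesis by (simp add: algebra_simps)
    qed
    moreover have "(\<lambda>N. s * integral {0..real N} (?E (Suc k))) \<longlonglongrightarrow> s * integral {0<..} (?E (Suc k))"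
      by (intro tendsto_intros integral_0_nat_tendsto absolutely_integrable_power_exp s)
    moreover have "(\<lambda>N. of_nat (Suc k) * integral {0..real N} (?E k) - ?E (Suc k) (real N)) \<longlonglongrightarrow> of_nat (Suc k) * integral {0<..} (?E k) - 0"
      by (intro tendsto_intros integral_0_nat_tendsto absolutely_integrable_power_exp s decay)
    ultimately have "s * integral {0<..} (?E (Suc k)) = of_nat (Suc k) * integral {0<..} (?E k) - 0"
      using LIMSEQ_unique by simp
    then have "integral {0<..} (?E (Suc k)) = of_nat (Suc k) * (fact k / s ^ Suc k) / s"
      unfolding Suc.IH diff_zero by (metis nonzero_mult_div_cancel_left s0)
    then show ?case by (simp only: fact_Suc power_Suc of_nat_mult) (simp add: mult_ac)
  }
qed

lemma has_integral_power_exp: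
  fixes s :: complex
  assumes "Re s > 0"
  shows "((\<lambda>y. of_real (y ^ k) * exp (- s * of_real y)) has_integral fact k / s ^ Suc k) {0<..}"
  unfolding has_integral_iff
  using integral_power_exp[OF assms] set_lebesgue_integral_eq_integral(1)[OF absolutely_integrable_power_exp[OF assms]]
  by blast

text \<open>This is \<open>sinh (v y (1/2 - \<theta>)) / sinh (v y / 2)\<close>; the value at \<open>0\<close> makes it continuous.\<close>
definition sinh_ratio :: "real \<Rightarrow> real \<Rightarrow> real \<Rightarrow> real" where
  "sinh_ratio v \<theta> y =
     (if y = 0 then 1 - 2 * \<theta> else (exp (- v * \<theta> * y) - exp (- v * (1 - \<theta>) * y)) / (1 - exp (- v * y)))"

text \<open>The geometric expansion of 1/(1 - exp(-v y)) turns the kernel into differences of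
  exponentials, whose cosine transforms are elementary.\<close>

lemma sinh_ratio_sums:
  fixes v :: real
  assumes "v > 0" "y > 0"
  shows "(\<lambda>m. exp (- v * (real m + \<theta>) * y) - exp (- v * (real m + (1 - \<theta>)) * y)) sums sinh_ratio v \<theta> y"
proof -
  have "norm (exp (- v * y)) < 1" using assms by simp
  then have "(\<lambda>m. (exp (- v * \<theta> * y) - exp (- v * (1 - \<theta>) * y)) * exp (- v * y) ^ m) sums
     ((exp (- v * \<theta> * y) - exp (- v * (1 - \<theta>) * y)) * (1 / (1 - exp (- v * y))))"
    by (intro sums_mult geometric_sums)
  moreover have "(exp (- v * \<theta> * y) - exp (- v * (1 - \<theta>) * y)) * exp (- v * y) ^ m =
      exp (- v * (real m + \<theta>) * y) - exp (- v * (real m + (1 - \<theta>)) * y)" for m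
    by (simp add: exp_of_nat_mult[symmetric] left_diff_distrib exp_add[symmetric] algebra_simps)
  ultimately show ?thesis using assms by (simp add: sinh_ratio_def)
qed

text \<open>The series of \<open>sinh_ratio_sums\<close> is integrated term by term. The exchange
  needs a finite sum of L1 norms; as the terms share one sign, this sum is up to sign the sum of
  their integrals at frequency 0, which converges by \<open>sums_Polygamma_diff\<close> even for k =
  0.\<close>

lemma sinh_ratio_cos_transform:
  fixes v \<theta> \<omega> :: real
  assumes v: "v > 0" and th: "0 < \<theta>" "\<theta> < 1" and k: "even k"
  defines "s \<equiv> \<lambda>\<beta>. Complex (v * \<beta>) (- \<omega>)"
  shows "(\<lambda>y. y ^ k * sinh_ratio v \<theta> y * cos (\<omega> * y)) absolutely_integrable_on {0<..}"
    and "(\<lambda>m. fact k * Re (1 / s (real m + \<theta>) ^ Suc k - 1 / s (real m + (1 - \<theta>)) ^ Suc k)) sums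
          integral {0<..} (\<lambda>y. y ^ k * sinh_ratio v \<theta> y * cos (\<omega> * y))"
proof -
  \<comment> \<open>The terms carry exp(i omega y) in place of the cosine, so that their norm is
    |\<open>f0 m y\<close>|, free of the frequency; the real part is taken at the end.\<close>
  define f where "f m y = of_real (y ^ k) * exp (- s (real m + \<theta>) * of_real y) - of_real (y ^ k) * exp (- s (real m + (1 - \<theta>)) * of_real y)" for m y
  define f0 where "f0 m y = y ^ k * (exp (- v * (real m + \<theta>) * y) - exp (- v * (real m + (1 - \<theta>)) * y))" for m y
  have s: "Re (s (real m + \<theta>)) > 0" "Re (s (real m + (1 - \<theta>))) > 0" for m
    using v th by (auto simp: s_def intro!: mult_pos_pos add_nonneg_pos)
  have fi: "f m absolutely_integrable_on {0<..}" for m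
    unfolding f_def by (intro set_integral_diff absolutely_integrable_power_exp s)
  have fI: "integral {0<..} (f m) = fact k * (1 / s (real m + \<theta>) ^ Suc k - 1 / s (real m + (1 - \<theta>)) ^ Suc k)" for m
    unfolding f_def
    using integral_unique[OF has_integral_diff[OF has_integral_power_exp[OF s(1)] has_integral_power_exp[OF s(2)]]]
    by (simp only: right_diff_distrib times_divide_eq_right mult_1_right)
  have eE: "exp (- s \<beta> * of_real y) = of_real (exp (- v * \<beta> * y)) * exp (\<i> * of_real (\<omega> * y))" for \<beta> y
  proof -
    have "- s \<beta> * of_real y = of_real (- v * \<beta> * y) + \<i> * of_real (\<omega> * y)"
      by (simp add: s_def complex_eq_iff)
    then show ?thesis by (simp only: exp_add exp_of_real)
  qed
  have ff0: "f m y = of_real (f0 m y) * exp (\<i> * of_real (\<omega> * y))" for m y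
    unfolding f_def eE f0_def by (simp add: algebra_simps)
  have nf: "norm (f m y) = \<bar>f0 m y\<bar>" for m y
    by (simp add: ff0 norm_mult)
  \<comment> \<open>The common sign of all the differences: the exponential with the smaller of
    \<open>\<theta>\<close> and \<open>1 - \<theta>\<close> is the larger one, for every
    \<open>m\<close> and every \<open>y > 0\<close>.\<close>
  define \<sigma> :: real where "\<sigma> = (if \<theta> \<le> 1/2 then 1 else -1)"
  have f0_abs: "\<bar>f0 m y\<bar> = \<sigma> * f0 m y" if "y > 0" for m y
  proof (cases "\<theta> \<le> 1/2")
    case True
    then have "v * (real m + \<theta>) * y \<le> v * (real m + (1 - \<theta>)) * y"
      using that v by (intro mult_right_mono mult_left_mono) auto
    then have "f0 m y \<ge> 0" unfolding f0_def using that by (intro mult_nonneg_nonneg) auto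
    then show ?thesis using True by (simp add: \<sigma>_def)
  next
    case False
    then have "v * (real m + (1 - \<theta>)) * y \<le> v * (real m + \<theta>) * y"
      using that v by (intro mult_right_mono mult_left_mono) auto
    then have "f0 m y \<le> 0" unfolding f0_def using that by (intro mult_nonneg_nonpos) auto
    then show ?thesis using False by (simp add: \<sigma>_def)
  qed
  have f0_sums: "(\<lambda>m. f0 m y) sums (y ^ k * sinh_ratio v \<theta> y)" if "y > 0" for y
    unfolding f0_def by (intro sums_mult sinh_ratio_sums v that)
  have f0I: "integral {0<..} (f0 m) = fact k / v ^ Suc k * (1 / (real m + \<theta>) ^ Suc k - 1 / (real m + (1 - \<theta>)) ^ Suc k)" for m
  proof -
    have "((\<lambda>y. of_real (y ^ k) * exp (- of_real (v * \<beta>) * of_real y)) has_integral fact k / (of_real (v * \<beta>) :: complex) ^ Suc k) {0<..}"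
      if "\<beta> > 0" for \<beta>
      using that v by (intro has_integral_power_exp) auto
    then have A: "((\<lambda>y. Re (of_real (y ^ k) * exp (- of_real (v * \<beta>) * of_real y))) has_integral Re (fact k / (of_real (v * \<beta>) :: complex) ^ Suc k)) {0<..}"
      if "\<beta> > 0" for \<beta>
      using has_integral_linear[OF _ bounded_linear_Re] that unfolding o_def by blast
    have B: "Re (of_real (y ^ k) * exp (- of_real (v * \<beta>) * of_real y)) = y ^ k * exp (- v * \<beta> * y)" for y \<beta>
    proof -
      have "of_real (y ^ k) * exp (- of_real (v * \<beta>) * of_real y) = complex_of_real (y ^ k * exp (- v * \<beta> * y))"
        by (simp add: exp_of_real[symmetric] del: exp_of_real)
      then show ?thesis by (simp only: Re_complex_of_real)
    qed
    have C: "Re (fact k / (of_real (v * \<beta>) :: complex) ^ Suc k) = fact k / v ^ Suc k * (1 / \<beta> ^ Suc k)" for \<beta>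
    proof -
      have "fact k / (of_real (v * \<beta>) :: complex) ^ Suc k = of_real (fact k / v ^ Suc k * (1 / \<beta> ^ Suc k))"
        by (simp add: power_mult_distrib)
      then show ?thesis by (simp only: Re_complex_of_real)
    qed
    have *: "((\<lambda>y. y ^ k * exp (- v * \<beta> * y)) has_integral fact k / v ^ Suc k * (1 / \<beta> ^ Suc k)) {0<..}"
      if "\<beta> > 0" for \<beta> using A[OF that] by (simp only: B C)
    have "(f0 m has_integral fact k / v ^ Suc k * (1 / (real m + \<theta>) ^ Suc k) - fact k / v ^ Suc k * (1 / (real m + (1 - \<theta>)) ^ Suc k)) {0<..}"
      unfolding f0_def right_diff_distrib using th by (intro has_integral_diff *) auto
    then show ?thesis by (simp add: integral_unique right_diff_distrib)
  qed
  have "summable (\<lambda>m. 1 / (real m + \<theta>) ^ Suc k - 1 / (real m + (1 - \<theta>)) ^ Suc k)"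
    using sums_Polygamma_diff[of \<theta> k] th k by (simp add: sums_iff)
  then have "summable (\<lambda>m. \<sigma> * (fact k / v ^ Suc k * (1 / (real m + \<theta>) ^ Suc k - 1 / (real m + (1 - \<theta>)) ^ Suc k)))"
    by (intro summable_mult)
  also have "(\<lambda>m. \<sigma> * (fact k / v ^ Suc k * (1 / (real m + \<theta>) ^ Suc k - 1 / (real m + (1 - \<theta>)) ^ Suc k))) =
      (\<lambda>m. integral {0<..} (\<lambda>y. norm (f m y)))"
  proof
    fix m
    have "integral {0<..} (\<lambda>y. norm (f m y)) = integral {0<..} (\<lambda>y. \<sigma> * f0 m y)"
      by (rule integral_cong) (simp add: nf f0_abs)
    then show "\<sigma> * (fact k / v ^ Suc k * (1 / (real m + \<theta>) ^ Suc k - 1 / (real m + (1 - \<theta>)) ^ Suc k)) = integral {0<..} (\<lambda>y. norm (f m y))"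
      by (simp add: f0I)
  qed
  finally have int: "summable (\<lambda>m. integral {0<..} (\<lambda>y. norm (f m y)))" .
  have summ: "summable (\<lambda>m. norm (f m y))" if "y \<in> {0<..}" for y
    using summable_mult[OF sums_summable[OF f0_sums[of y]], of \<sigma>] that by (simp add: nf f0_abs)
  note S = absolutely_integrable_suminf[OF _ fi summ int, simplified]
  have F: "(\<Sum>m. f m y) = of_real (y ^ k * sinh_ratio v \<theta> y) * exp (\<i> * of_real (\<omega> * y))" if "y > 0" for y
  proof -
    have "(\<lambda>m. f m y) sums (of_real (y ^ k * sinh_ratio v \<theta> y) * exp (\<i> * of_real (\<omega> * y)))"
      unfolding ff0 by (intro sums_mult2 sums_of_real f0_sums that)
    then show ?thesis by (simp add: sums_iff)
  qed
  have ReF: "Re (\<Sum>m. f m y) = y ^ k * sinh_ratio v \<theta> y * cos (\<omega> * y)" if "y > 0" for y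
    unfolding F[OF that] by (simp add: Re_exp)
  have "(\<lambda>y. Re (\<Sum>m. f m y)) absolutely_integrable_on {0<..}"
    using absolutely_integrable_linear[OF S(1) bounded_linear_Re] by (simp add: o_def)
  then show "(\<lambda>y. y ^ k * sinh_ratio v \<theta> y * cos (\<omega> * y)) absolutely_integrable_on {0<..}"
    by (rule absolutely_integrable_spike[of _ _ "{}"]) (use ReF in auto)
  have "Re (integral {0<..} (\<lambda>y. \<Sum>m. f m y)) = integral {0<..} (\<lambda>y. Re (\<Sum>m. f m y))"
    using integral_linear[OF set_lebesgue_integral_eq_integral(1)[OF S(1)] bounded_linear_Re] by (simp add: o_def)
  also have "\<dots> = integral {0<..} (\<lambda>y. y ^ k * sinh_ratio v \<theta> y * cos (\<omega> * y))"
    by (rule integral_cong) (simp add: ReF)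
  moreover have "Re (fact k * w) = fact k * Re w" for w
  proof -
    have "fact k * w = of_real (fact k) * w" by simp
    then show ?thesis by (simp only: times_complex.sel Re_complex_of_real Im_complex_of_real mult_zero_left diff_zero)
  qed
  ultimately show "(\<lambda>m. fact k * Re (1 / s (real m + \<theta>) ^ Suc k - 1 / s (real m + (1 - \<theta>)) ^ Suc k)) sums
          integral {0<..} (\<lambda>y. y ^ k * sinh_ratio v \<theta> y * cos (\<omega> * y))"
    using sums_Re[OF S(2)] by (simp add: fI)
qed

subsection \<open>Transformation of the Lambert series\<close>

lemma continuous_on_sinh_ratio:
  assumes v: "v > 0"
  shows "continuous_on {0..} (sinh_ratio v \<theta>)"
proof -
  define F where "F y = (exp (- v * \<theta> * y) - exp (- v * (1 - \<theta>) * y)) / (1 - exp (- v * y))" for y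
  \<comment> \<open>Numerator and denominator both vanish at 0, so the limit there is the quotient v
    (1 - 2 theta)/v of their derivatives.\<close>
  have "((\<lambda>y. exp (- v * \<theta> * y) - exp (- v * (1 - \<theta>) * y)) has_field_derivative v * (1 - 2 * \<theta>)) (at 0)"
    by (auto intro!: derivative_eq_intros simp: algebra_simps)
  moreover have "((\<lambda>y. 1 - exp (- v * y)) has_field_derivative v) (at 0)"
    by (auto intro!: derivative_eq_intros)
  ultimately have "((\<lambda>h. ((exp (- v * \<theta> * h) - exp (- v * (1 - \<theta>) * h)) / h) / ((1 - exp (- v * h)) / h)) \<longlongrightarrow> v * (1 - 2 * \<theta>) / v) (at 0)"
    using v by (intro tendsto_divide) (auto simp: DERIV_def)
  moreover have "v * (1 - 2 * \<theta>) / v = 1 - 2 * \<theta>" using v by simp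
  ultimately have "((\<lambda>h. ((exp (- v * \<theta> * h) - exp (- v * (1 - \<theta>) * h)) / h) / ((1 - exp (- v * h)) / h)) \<longlongrightarrow> 1 - 2 * \<theta>) (at 0)"
    by (simp only:)
  then have "(F \<longlongrightarrow> 1 - 2 * \<theta>) (at 0)"
    by (rule Lim_transform_eventually) (use v in \<open>auto simp: F_def eventually_at_filter\<close>)
  then have "(F \<longlongrightarrow> 1 - 2 * \<theta>) (at 0 within {0..})"
    by (rule tendsto_within_subset) simp
  then have at0: "(sinh_ratio v \<theta> \<longlongrightarrow> 1 - 2 * \<theta>) (at 0 within {0..})"
    by (rule Lim_transform_eventually) (auto simp: F_def sinh_ratio_def eventually_at_filter)
  have "continuous_on {0<..} F"
    unfolding F_def using v by (intro continuous_intros) auto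
  then have "continuous_on {0<..} (sinh_ratio v \<theta>)"
    by (rule continuous_on_cong[THEN iffD1, rotated -1]) (auto simp: F_def sinh_ratio_def)
  then have "continuous (at y within {0..}) (sinh_ratio v \<theta>)" if "y > 0" for y
    using that continuous_at_imp_continuous_at_within by (auto simp: continuous_on_eq_continuous_at)
  moreover have "continuous (at 0 within {0..}) (sinh_ratio v \<theta>)"
    using at0 by (simp add: continuous_within sinh_ratio_def)
  ultimately show ?thesis
    unfolding continuous_on_eq_continuous_within by (metis atLeast_iff order_le_less)
qed

text \<open>For \<open>y\<close> at least 1 the denominator stays above 1 - exp(-v), so the slower
  of the two exponentials controls the kernel. In \<open>Lambert_transform\<close> the unit interval
  next to 0 is covered by compactness instead.\<close>

lemma sinh_ratio_bound:
  assumes v: "v > 0" and th: "0 < \<theta>" "\<theta> < 1" and y: "y \<ge> 1"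
  shows "\<bar>sinh_ratio v \<theta> y\<bar> \<le> exp (- v * min \<theta> (1 - \<theta>) * y) / (1 - exp (- v))"
proof -
  have "\<bar>exp (- v * \<theta> * y) - exp (- v * (1 - \<theta>) * y)\<bar> \<le> exp (- v * min \<theta> (1 - \<theta>) * y)"
  proof -
    have "exp (- v * \<theta> * y) \<le> exp (- v * min \<theta> (1 - \<theta>) * y)" "exp (- v * (1 - \<theta>) * y) \<le> exp (- v * min \<theta> (1 - \<theta>) * y)"
      using v y by (auto intro!: mult_right_mono mult_left_mono)
    moreover have "exp (- v * \<theta> * y) > 0" "exp (- v * (1 - \<theta>) * y) > 0" by auto
    ultimately show ?thesis by linarith
  qed
  moreover have "0 < 1 - exp (- v)" "1 - exp (- v) \<le> 1 - exp (- v * y)"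
    using v y by auto
  ultimately have "\<bar>exp (- v * \<theta> * y) - exp (- v * (1 - \<theta>) * y)\<bar> / (1 - exp (- v * y)) \<le> exp (- v * min \<theta> (1 - \<theta>) * y) / (1 - exp (- v))"
    by (intro frac_le) auto
  then show ?thesis using y v by (simp add: sinh_ratio_def abs_divide)
qed

text \<open>Poisson summation for \<open>g\<close>. Frequency 0 leaves the real partial-fraction
  series, later recognised as the Hurwitz zeta difference; a positive frequency leads through
  \<open>Re_sums_Lambert\<close> to one inner Lambert sum \<open>L e\<close>.\<close>

lemma Lambert_transform:
  fixes v \<theta> \<psi> :: real
  assumes v: "v > 0" and th: "0 < \<theta>" "\<theta> < 1" and ps: "\<psi> \<in> {0..1}" and k: "even k"
  defines "g \<equiv> \<lambda>y. y ^ k * sinh_ratio v \<theta> y"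
    and "L \<equiv> \<lambda>e. \<Sum>d. real (Suc d) ^ k * sin (2 * pi * real (Suc d) * \<theta>) * exp (- (4 * pi\<^sup>2 / v) * (real (Suc d) * real (Suc e)))"
  shows "(\<Sum>n. g (real n + \<psi>) + g (real n + 1 - \<psi>)) =
      2 * fact k / v ^ Suc k * (\<Sum>m. 1 / (real m + \<theta>) ^ Suc k - 1 / (real m + (1 - \<theta>)) ^ Suc k)
    + 4 * (2 * pi) ^ Suc k * (-1) ^ (k div 2) / v ^ Suc k * (\<Sum>e. L e * cos (2 * pi * real (Suc e) * \<psi>))"
proof -
  define I where "I e = integral {0<..} (\<lambda>y. g y * cos (2 * pi * real e * y))" for e
  define u where "u = 4 * pi\<^sup>2 / v"
  define w where "w d = real (Suc d) ^ k * exp (- u * real (Suc d))" for d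
  have u: "u > 0" using v by (simp add: u_def)
  have ws: "summable w"
  proof -
    have "summable (\<lambda>d. real d ^ k * exp (- u) ^ d)"
      by (rule summable_of_nat_power_times_power) (use u in auto)
    then have "summable (\<lambda>d. real (Suc d) ^ k * exp (- u) ^ Suc d)"
      by (rule summable_Suc_iff[THEN iffD2])
    then show ?thesis unfolding w_def exp_of_nat_mult[symmetric] by (simp only: mult.commute)
  qed
  have wb: "\<bar>real (Suc d) ^ k * sin (2 * pi * real (Suc d) * \<theta>) * exp (- u * (real (Suc d) * real (Suc e)))\<bar> \<le> exp (- u) ^ e * w d" for d e
  proof -
    \<comment> \<open>This inequality decouples the indices: the double Lambert terms are bounded by
      a product, geometric in \<open>e\<close> and summable in \<open>d\<close>.\<close>
    have "real (Suc d) * real (Suc e) \<ge> real (Suc d) + real e" by (simp add: algebra_simps)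
    then have "exp (- u * (real (Suc d) * real (Suc e))) \<le> exp (- u * (real (Suc d) + real e))"
      using u by simp
    also have "\<dots> = exp (- u) ^ e * exp (- u * real (Suc d))"
      by (simp add: exp_of_nat_mult[symmetric] exp_add[symmetric] algebra_simps)
    finally have "exp (- u * (real (Suc d) * real (Suc e))) \<le> exp (- u) ^ e * exp (- u * real (Suc d))" .
    then have "real (Suc d) ^ k * \<bar>sin (2 * pi * real (Suc d) * \<theta>)\<bar> * exp (- u * (real (Suc d) * real (Suc e)))
        \<le> real (Suc d) ^ k * 1 * (exp (- u) ^ e * exp (- u * real (Suc d)))"
      by (intro mult_mono) auto
    then show ?thesis by (simp add: abs_mult w_def mult_ac del: of_nat_Suc)
  qed
  have Lb: "\<bar>L e\<bar> \<le> exp (- u) ^ e * suminf w" for e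
  proof -
    have "norm (L e) \<le> (\<Sum>d. exp (- u) ^ e * w d)"
      unfolding L_def u_def[symmetric] by (rule norm_suminf_le) (use wb ws in \<open>auto intro: summable_mult simp del: of_nat_Suc\<close>)
    then show ?thesis by (simp add: suminf_mult[OF ws])
  qed
  have "summable (\<lambda>e. exp (- u) ^ e * suminf w)"
    using u by (intro summable_mult2 summable_geometric) auto
  then have Ls: "summable (\<lambda>e. \<bar>L e\<bar>)"
    by (rule summable_comparison_test[rotated]) (use Lb in auto)
  have cg: "continuous_on {0..} g"
    unfolding g_def by (intro continuous_intros continuous_on_sinh_ratio v)
  obtain B where B: "\<And>y. y \<in> {0..1} \<Longrightarrow> \<bar>g y\<bar> \<le> B"
  proof -
    have "bounded (g ` {0..1})"
      by (intro compact_imp_bounded compact_continuous_image continuous_on_subset[OF cg]) auto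
    then obtain b where "\<forall>y\<in>{0..1}. \<bar>g y\<bar> \<le> b" by (auto simp: bounded_iff)
    then show ?thesis using that by blast
  qed
  define r where "r = exp (- v * min \<theta> (1 - \<theta>))"
  have r: "0 < r" "r < 1" using v th by (auto simp: r_def mult_pos_pos)
  \<comment> \<open>On the first unit interval the bound is the maximum \<open>B\<close> of a
    continuous function; further out it is the exponential decay, with y^k bounded at the right end
    of the interval and the exponential at the left end.\<close>
  define M where "M n = (if n = 0 then B else real (Suc n) ^ k * r ^ n / (1 - exp (- v)))" for n
  have gb: "\<bar>g y\<bar> \<le> M n" if "real n \<le> y" "y \<le> real n + 1" for n y
  proof (cases "n = 0")
    case True
    then show ?thesis using B that by (simp add: M_def)
  next
    case False
    then have y: "y \<ge> 1" using that by linarith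
    have "exp (- v * min \<theta> (1 - \<theta>) * y) \<le> exp (- v * min \<theta> (1 - \<theta>) * real n)"
      using that v th by (auto intro!: mult_left_mono)
    also have "\<dots> = r ^ n" unfolding r_def exp_of_nat_mult[symmetric] by (simp add: mult_ac)
    finally have "exp (- v * min \<theta> (1 - \<theta>) * y) / (1 - exp (- v)) \<le> r ^ n / (1 - exp (- v))"
      using v by (intro divide_right_mono) auto
    then have "\<bar>sinh_ratio v \<theta> y\<bar> \<le> r ^ n / (1 - exp (- v))"
      using sinh_ratio_bound[OF v th y] by linarith
    moreover have "\<bar>y ^ k\<bar> \<le> real (Suc n) ^ k"
      unfolding power_abs using y that by (intro power_mono) auto
    ultimately have "\<bar>g y\<bar> \<le> real (Suc n) ^ k * (r ^ n / (1 - exp (- v)))"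
      unfolding g_def abs_mult by (intro mult_mono) auto
    then show ?thesis using False by (simp add: M_def)
  qed
  have Ms: "summable M"
  proof -
    have "summable (\<lambda>n. real n ^ k * r ^ n)"
      by (rule summable_of_nat_power_times_power) (use r in auto)
    then have "summable (\<lambda>n. real (Suc n) ^ k * r ^ Suc n)"
      by (rule summable_Suc_iff[THEN iffD2])
    then have "summable (\<lambda>n. real (Suc n) ^ k * r ^ Suc n * (1 / (r * (1 - exp (- v)))))"
      by (rule summable_mult2)
    also have "(\<lambda>n. real (Suc n) ^ k * r ^ Suc n * (1 / (r * (1 - exp (- v))))) = (\<lambda>n. real (Suc n) ^ k * r ^ n / (1 - exp (- v)))"
      using r v by (auto simp: fun_eq_iff simp del: of_nat_Suc)
    finally have "summable (\<lambda>n. real (Suc n) ^ k * r ^ n / (1 - exp (- v)))" .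
    then show ?thesis
      by (rule summable_cong[THEN iffD1, rotated])
         (auto simp: M_def eventually_sequentially intro!: exI[of _ 1])
  qed
  have I0: "I 0 = fact k / v ^ Suc k * (\<Sum>m. 1 / (real m + \<theta>) ^ Suc k - 1 / (real m + (1 - \<theta>)) ^ Suc k)"
  proof -
    have s: "summable (\<lambda>m. 1 / (real m + \<theta>) ^ Suc k - 1 / (real m + (1 - \<theta>)) ^ Suc k)"
      using sums_Polygamma_diff[of \<theta> k] th k by (simp add: sums_iff)
    have "Re (1 / Complex (v * \<beta>) (- 0) ^ Suc k - 1 / Complex (v * \<beta>') (- 0) ^ Suc k) =
        1 / v ^ Suc k * (1 / \<beta> ^ Suc k - 1 / \<beta>' ^ Suc k)" for \<beta> \<beta>'
    proof -
      have "1 / Complex (v * \<beta>) (- 0) ^ Suc k - 1 / Complex (v * \<beta>') (- 0) ^ Suc k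
         = complex_of_real (1 / v ^ Suc k * (1 / \<beta> ^ Suc k - 1 / \<beta>' ^ Suc k))"
        by (simp add: complex_of_real_def[symmetric] power_mult_distrib right_diff_distrib mult_ac del: complex_of_real_def)
      then show ?thesis by (simp only: Re_complex_of_real)
    qed
    then have "(\<lambda>m. fact k * (1 / v ^ Suc k * (1 / (real m + \<theta>) ^ Suc k - 1 / (real m + (1 - \<theta>)) ^ Suc k))) sums I 0"
      using sinh_ratio_cos_transform(2)[OF v th k, of 0] by (simp only: I_def g_def of_nat_0 mult_zero_right)
    then have "I 0 = (\<Sum>m. fact k / v ^ Suc k * (1 / (real m + \<theta>) ^ Suc k - 1 / (real m + (1 - \<theta>)) ^ Suc k))"
      by (simp add: sums_iff)
    then show ?thesis by (simp only: suminf_mult[OF s])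
  qed
  have IS: "I (Suc e) = (2 * pi) ^ Suc k * (-1) ^ (k div 2) / v ^ Suc k * L e" for e
  proof -
    \<comment> \<open>The frequency 2 pi (e+1) divided by \<open>v\<close>: pulling \<open>v\<close>
      out of v (m + theta) - 2 pi i (e+1) leaves m + theta - i eta. The exponent 2 pi d eta is then
      4 pi^2 d (e+1)/v, as in \<open>L\<close>.\<close>
    define \<eta> where "\<eta> = 2 * pi * real (Suc e) / v"
    have \<eta>: "\<eta> > 0" using v by (simp add: \<eta>_def)
    define z where "z = Complex \<theta> (- \<eta>)"
    have 1: "Complex (v * (real m + \<theta>)) (- (2 * pi * real (Suc e))) = of_real v * (of_nat m + z)" for m
      using v by (simp add: z_def complex_eq_iff \<eta>_def)
    \<comment> \<open>In the second half the frequency enters with the sign opposite to that in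
      \<open>1 - z\<close>, so a conjugate appears; the real part does not see it.\<close>
    have 2: "Complex (v * (real m + (1 - \<theta>))) (- (2 * pi * real (Suc e))) = cnj (of_real v * (of_nat m + (1 - z)))" for m
      using v by (simp add: z_def complex_eq_iff \<eta>_def)
    have 3: "Re (1 / (of_real v * w) ^ Suc k - 1 / (cnj (of_real v * w')) ^ Suc k) = Re (1 / w ^ Suc k - 1 / w' ^ Suc k) / v ^ Suc k" for w w'
    proof -
      have "Re (1 / (cnj (of_real v * w')) ^ Suc k) = Re (1 / (of_real v * w') ^ Suc k)"
        by (metis complex_cnj_cnj complex_cnj_divide complex_cnj_one complex_cnj_power cnj.sel(1))
      then have "Re (1 / (of_real v * w) ^ Suc k - 1 / (cnj (of_real v * w')) ^ Suc k) = Re (1 / (of_real v * w) ^ Suc k - 1 / (of_real v * w') ^ Suc k)"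
        by simp
      also have "1 / (of_real v * w) ^ Suc k - 1 / (of_real v * w') ^ Suc k = (1 / w ^ Suc k - 1 / w' ^ Suc k) / of_real (v ^ Suc k)"
        by (simp add: power_mult_distrib diff_divide_distrib mult_ac)
      finally show ?thesis by (simp only: Re_divide_of_real)
    qed
    have "(\<lambda>m. fact k * (Re (1 / (of_nat m + z) ^ Suc k - 1 / (of_nat m + (1 - z)) ^ Suc k) / v ^ Suc k)) sums I (Suc e)"
      using sinh_ratio_cos_transform(2)[OF v th k, of "2 * pi * real (Suc e)"]
      unfolding 1 2 3 I_def g_def .
    moreover have "(\<lambda>m. fact k * (Re (1 / (of_nat m + z) ^ Suc k - 1 / (of_nat m + (1 - z)) ^ Suc k) / v ^ Suc k)) sums
       (fact k * ((2 * pi) ^ (k + 1) * (-1) ^ (k div 2) / fact k *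
       (\<Sum>d. real (Suc d) ^ k * sin (2 * pi * real (Suc d) * \<theta>) * exp (- (2 * pi * real (Suc d) * \<eta>))) / v ^ Suc k))"
      unfolding z_def by (intro sums_mult sums_divide Re_sums_Lambert k \<eta>)
    ultimately have "I (Suc e) = fact k * ((2 * pi) ^ (k + 1) * (-1) ^ (k div 2) / fact k *
       (\<Sum>d. real (Suc d) ^ k * sin (2 * pi * real (Suc d) * \<theta>) * exp (- (2 * pi * real (Suc d) * \<eta>))) / v ^ Suc k)"
      by (rule sums_unique2)
    also have "(\<Sum>d. real (Suc d) ^ k * sin (2 * pi * real (Suc d) * \<theta>) * exp (- (2 * pi * real (Suc d) * \<eta>))) = L e"
      unfolding L_def \<eta>_def by (intro suminf_cong arg_cong2[of _ _ _ _ "(*)"] refl arg_cong[of _ _ exp])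
        (simp add: power2_eq_square field_simps)
    finally show ?thesis by simp
  qed
  have lim: "(\<lambda>N. integral {0..real N} (\<lambda>y. g y * cos (2 * pi * real e * y))) \<longlonglongrightarrow> I e" for e
    unfolding I_def g_def by (intro integral_0_nat_tendsto sinh_ratio_cos_transform(1) v th k)
  have Is: "summable (\<lambda>e. \<bar>I e\<bar>)"
  proof -
    have "summable (\<lambda>e. \<bar>(2 * pi) ^ Suc k * (-1) ^ (k div 2) / v ^ Suc k\<bar> * \<bar>L e\<bar>)"
      by (rule summable_mult[OF Ls])
    then have "summable (\<lambda>e. \<bar>I (Suc e)\<bar>)" by (simp only: IS abs_mult)
    then show ?thesis by (rule summable_Suc_iff[THEN iffD1])
  qed
  have Lcs: "summable (\<lambda>e. L e * cos (2 * pi * real (Suc e) * \<psi>))"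
    by (rule summable_comparison_test[OF _ Ls]) (auto simp: abs_mult intro!: mult_left_le)
  have "(\<Sum>n. g (real n + \<psi>) + g (real n + 1 - \<psi>)) = 2 * I 0 + 4 * (\<Sum>e. I (Suc e) * cos (2 * pi * real (Suc e) * \<psi>))"
    by (rule poisson_summation_cos[OF cg gb Ms lim Is ps])
  also have "(\<Sum>e. I (Suc e) * cos (2 * pi * real (Suc e) * \<psi>)) =
      (2 * pi) ^ Suc k * (-1) ^ (k div 2) / v ^ Suc k * (\<Sum>e. L e * cos (2 * pi * real (Suc e) * \<psi>))"
    unfolding IS by (subst suminf_mult[OF Lcs, symmetric]) (simp only: mult.assoc)
  finally show "(\<Sum>n. g (real n + \<psi>) + g (real n + 1 - \<psi>)) =
      2 * fact k / v ^ Suc k * (\<Sum>m. 1 / (real m + \<theta>) ^ Suc k - 1 / (real m + (1 - \<theta>)) ^ Suc k)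
    + 4 * (2 * pi) ^ Suc k * (-1) ^ (k div 2) / v ^ Suc k * (\<Sum>e. L e * cos (2 * pi * real (Suc e) * \<psi>))"
    unfolding I0 by (simp only: times_divide_eq_right times_divide_eq_left mult.assoc)
qed

subsection \<open>Bessel and Hurwitz functions\<close>

lemma power_le_fact_exp:
  fixes y :: real
  assumes "y \<ge> 0"
  shows "y ^ j \<le> fact j * exp y"
proof -
  have "(\<lambda>n. y ^ n / fact n) sums exp y"
    using exp_converges[of y] by (simp add: field_simps)
  then have "(\<Sum>n\<in>{j}. y ^ n / fact n) \<le> exp y"
    using sum_le_suminf[of "\<lambda>n. y ^ n / fact n" "{j}"] assms by (auto simp: sums_iff)
  then show ?thesis by (simp add: field_simps)
qed

lemma Gamma_integral_scaled:
  fixes z :: complex and b :: real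
  assumes z: "Re z > 0" and b: "b > 0"
  shows "(\<lambda>t. of_real t powr (z - 1) * of_real (exp (- (b * t)))) absolutely_integrable_on {0<..}"
    and "integral {0<..} (\<lambda>t. of_real t powr (z - 1) * of_real (exp (- (b * t)))) = Gamma z / of_real b powr z"
proof -
  let ?f = "\<lambda>t. complex_of_real t powr (z - 1) * of_real (exp (- t))"
  have f: "?f absolutely_integrable_on {0<..}" "integral {0<..} ?f = Gamma z"
    using absolutely_integrable_Gamma_integral'[OF z] integral_unique[OF Gamma_integral_complex'[OF z]]
    by (simp_all add: exp_minus field_simps)
  have img: "(\<lambda>t. b * t) ` {0<..} = {0<..}"
    using b by (auto simp: image_iff intro!: bexI[of _ "_ / b"])
  have C: "(\<lambda>t. \<bar>b\<bar> *\<^sub>R ?f (b * t)) absolutely_integrable_on {0<..} \<and> integral {0<..} (\<lambda>t. \<bar>b\<bar> *\<^sub>R ?f (b * t)) = Gamma z"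
    by (subst has_absolute_integral_change_of_variables_real[where g = "\<lambda>t. b * t"])
       (use b f img in \<open>auto intro!: derivative_eq_intros inj_onI\<close>)
  have E: "\<bar>b\<bar> *\<^sub>R ?f (b * t) = of_real b powr z * (of_real t powr (z - 1) * of_real (exp (- (b * t))))" if "t > 0" for t
  proof -
    have "complex_of_real (b * t) powr (z - 1) = of_real b powr (z - 1) * of_real t powr (z - 1)"
      using b that by (simp add: powr_times_real)
    moreover have "of_real b powr z = of_real b * complex_of_real b powr (z - 1)"
      using b by (simp add: powr_diff)
    ultimately show ?thesis using b by (simp add: scaleR_conv_of_real)
  qed
  have *: "(\<lambda>t. of_real b powr z * (of_real t powr (z - 1) * of_real (exp (- (b * t))))) absolutely_integrable_on {0<..}"
      "integral {0<..} (\<lambda>t. of_real b powr z * (of_real t powr (z - 1) * of_real (exp (- (b * t))))) = Gamma z"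
  proof -
    show "(\<lambda>t. of_real b powr z * (of_real t powr (z - 1) * of_real (exp (- (b * t))))) absolutely_integrable_on {0<..}"
      by (rule absolutely_integrable_spike[OF conjunct1[OF C] negligible_empty]) (rule E[symmetric], simp)
    show "integral {0<..} (\<lambda>t. of_real b powr z * (of_real t powr (z - 1) * of_real (exp (- (b * t))))) = Gamma z"
      by (rule trans[OF integral_cong conjunct2[OF C]]) (rule E[symmetric], simp)
  qed
  have b0: "complex_of_real b powr z \<noteq> 0" using b by simp
  show "(\<lambda>t. of_real t powr (z - 1) * of_real (exp (- (b * t)))) absolutely_integrable_on {0<..}"
    using set_integrable_mult_right[OF *(1), of "inverse (of_real b powr z)"] b0 by (simp add: mult.assoc[symmetric])
  show "integral {0<..} (\<lambda>t. of_real t powr (z - 1) * of_real (exp (- (b * t)))) = Gamma z / of_real b powr z"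
    using *(2) b0 by (simp add: field_simps)
qed

text \<open>The substitution t = sqrt(c) exp(s) makes t + c/t equal to 2 sqrt(c) cosh(s) and t^nu
  equal to c^(nu/2) exp(nu s). Integrability follows from exp(-c/t) being at most 1, which leaves
  the Gamma integrand as a majorant.\<close>

lemma besselK_Mellin:
  fixes \<nu> :: complex and c :: real
  assumes \<nu>: "Re \<nu> > 0" and c: "c > 0"
  shows "(\<lambda>t. of_real t powr (\<nu> - 1) * of_real (exp (- t - c / t))) absolutely_integrable_on {0<..}"
    and "integral {0<..} (\<lambda>t. of_real t powr (\<nu> - 1) * of_real (exp (- t - c / t))) =
         2 * of_real c powr (\<nu> / 2) * besselK \<nu> (2 * sqrt c)"
proof -
  let ?f = "\<lambda>t. complex_of_real t powr (\<nu> - 1) * of_real (exp (- t - c / t))"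
  show f: "?f absolutely_integrable_on {0<..}"
  proof (rule measurable_bounded_by_integrable_imp_absolutely_integrable)
    have "continuous_on {0<..} ?f" by (intro continuous_intros) auto
    then show "?f \<in> borel_measurable (lebesgue_on {0<..})"
      by (rule continuous_imp_measurable_on_sets_lebesgue) simp
    show "(\<lambda>t. norm (complex_of_real t powr (\<nu> - 1) * of_real (exp (- (1 * t))))) integrable_on {0<..}"
      using Gamma_integral_scaled(1)[OF \<nu>, of 1] by (simp add: absolutely_integrable_on_def)
    show "norm (?f t) \<le> norm (complex_of_real t powr (\<nu> - 1) * of_real (exp (- (1 * t))))" if "t \<in> {0<..}" for t
      using that c unfolding norm_mult by (intro mult_left_mono) auto
  qed simp
  define h where "h s = complex_of_real c powr (\<nu> / 2) * (exp (\<nu> * of_real s) * of_real (exp (- (2 * sqrt c) * cosh s)))" for s :: real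
  have img: "(\<lambda>s. sqrt c * exp s) ` UNIV = {0<..}"
  proof -
    have "x \<in> range (\<lambda>s. sqrt c * exp s)" if "x > 0" for x
      using that c by (intro image_eqI[of _ _ "ln (x / sqrt c)"]) auto
    then show ?thesis using c by auto
  qed
  have "(\<lambda>s. \<bar>sqrt c * exp s\<bar> *\<^sub>R ?f (sqrt c * exp s)) absolutely_integrable_on UNIV \<and>
      integral UNIV (\<lambda>s. \<bar>sqrt c * exp s\<bar> *\<^sub>R ?f (sqrt c * exp s)) = integral {0<..} ?f"
    by (subst has_absolute_integral_change_of_variables_real[where g = "\<lambda>s. sqrt c * exp s"])
       (use c f img in \<open>auto intro!: derivative_eq_intros inj_onI\<close>)
  moreover have "\<bar>sqrt c * exp s\<bar> *\<^sub>R ?f (sqrt c * exp s) = h s" for s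
  proof -
    define t where "t = sqrt c * exp s"
    have t: "t > 0" using c by (simp add: t_def)
    have "c / t = sqrt c * exp (- s)"
      using c by (simp add: t_def exp_minus field_simps flip: real_sqrt_mult)
    then have e: "- t - c / t = - (2 * sqrt c) * cosh s"
      by (simp add: t_def cosh_def algebra_simps)
    have "of_real t * complex_of_real t powr (\<nu> - 1) = of_real t powr \<nu>"
      using t by (simp add: powr_diff)
    also have "\<dots> = exp (\<nu> * of_real (ln t))"
      using t by (simp add: powr_def Ln_of_real)
    also have "ln t = ln c / 2 + s"
      using c by (simp add: t_def ln_mult ln_sqrt)
    also have "exp (\<nu> * of_real (ln c / 2 + s)) = of_real c powr (\<nu> / 2) * exp (\<nu> * of_real s)"
      using c by (simp add: powr_def Ln_of_real exp_add[symmetric] algebra_simps)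
    finally have "of_real t * complex_of_real t powr (\<nu> - 1) = of_real c powr (\<nu> / 2) * exp (\<nu> * of_real s)" .
    then show ?thesis
      using t unfolding t_def[symmetric] h_def e by (simp add: scaleR_conv_of_real mult.assoc[symmetric])
  qed
  ultimately have h: "h absolutely_integrable_on UNIV" and hI: "integral UNIV h = integral {0<..} ?f" by simp_all
  have hS: "h absolutely_integrable_on S" if "S \<in> sets lebesgue" for S
    using set_integrable_subset[OF h that] by simp
  have img': "uminus ` {0..} = {..0::real}"
    by (auto simp: image_iff intro!: bexI[of _ "- _"])
  have "(\<lambda>s. \<bar>- 1\<bar> *\<^sub>R h (- s)) absolutely_integrable_on {0..} \<and>
      integral {0..} (\<lambda>s. \<bar>- 1 :: real\<bar> *\<^sub>R h (- s)) = integral {..0} h"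
    by (subst has_absolute_integral_change_of_variables_real[where g = uminus])
       (use img' hS in \<open>auto intro!: derivative_eq_intros\<close>)
  then have hm: "(\<lambda>s. h (- s)) absolutely_integrable_on {0..}" "integral {0..} (\<lambda>s. h (- s)) = integral {..0} h"
    by simp_all
  \<comment> \<open>Folding the line at s = 0 adds exp(nu s) and exp(-nu s), which yields the factor
    2 and the cosh in \<open>besselK\<close>.\<close>
  have "(h has_integral integral {0..} h + integral {..0} h) ({0..} \<union> {..0})"
    by (rule has_integral_Un) (auto intro!: integrable_integral set_lebesgue_integral_eq_integral(1) hS
      intro: negligible_subset[OF negligible_sing[of 0]])
  moreover have "{0..} \<union> {..0::real} = UNIV" by auto
  ultimately have "integral UNIV h = integral {0..} h + integral {0..} (\<lambda>s. h (- s))"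
    using hm by (simp add: integral_unique)
  also have "\<dots> = integral {0..} (\<lambda>s. h s + h (- s))"
    by (rule Henstock_Kurzweil_Integration.integral_add[symmetric])
       (auto intro!: set_lebesgue_integral_eq_integral(1) hS hm)
  also have "(\<lambda>s. h s + h (- s)) = (\<lambda>s. 2 * of_real c powr (\<nu> / 2) * (complex_of_real (exp (- (2 * sqrt c) * cosh s)) * cosh (\<nu> * complex_of_real s)))"
  proof
    show "h s + h (- s) = 2 * of_real c powr (\<nu> / 2) * (complex_of_real (exp (- (2 * sqrt c) * cosh s)) * cosh (\<nu> * complex_of_real s))" for s
      unfolding h_def cosh_minus by (simp add: cosh_def[of "\<nu> * of_real s"] scaleR_conv_of_real algebra_simps)
  qed
  also have "integral {0..} \<dots> = 2 * of_real c powr (\<nu> / 2) * besselK \<nu> (2 * sqrt c)"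
    by (simp add: besselK_def)
  finally show "integral {0<..} ?f = 2 * of_real c powr (\<nu> / 2) * besselK \<nu> (2 * sqrt c)"
    by (simp only: hI)
qed

section \<open>Hurwitz zeta differences at odd integers, including the limit at 1\<close>

lemma summable_shift_powr:
  fixes p s :: real
  assumes "p > 0" "s > 1"
  shows "summable (\<lambda>n. (real n + p) powr - s)"
proof (rule summable_comparison_test_ev)
  show "summable (\<lambda>n. real n powr - s)" using assms by (simp add: summable_real_powr_iff)
  show "eventually (\<lambda>n. norm ((real n + p) powr - s) \<le> real n powr - s) sequentially"
    using eventually_gt_at_top[of 0] by eventually_elim (use assms in \<open>auto intro!: powr_mono2'\<close>)
qed

text \<open>For positive \<open>k\<close> both zeta series converge and are subtracted termwise. For
  k = 0 the limit from the right at 1 has to pass under the sum; this is Tannery's theorem, applied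
  to the differences because only they have a summable majorant up to exponent 1.\<close>

lemma hurwitz_zeta_diff_nat:
  assumes th: "0 < \<theta>" "\<theta> < 1" and k: "even k"
  shows "hurwitz_zeta_diff (1 + real k) \<theta> = (\<Sum>m. 1 / (real m + \<theta>) ^ Suc k - 1 / (real m + (1 - \<theta>)) ^ Suc k)"
proof (cases "k = 0")
  case False
  have s: "summable (\<lambda>m. 1 / (real m + p) ^ Suc k)" if "p > 0" for p
  proof -
    have "(real m + p) powr - (1 + real k) = 1 / (real m + p) ^ Suc k" for m
      using that powr_realpow[of "real m + p" "Suc k"] unfolding powr_minus by (simp add: inverse_eq_divide)
    then show ?thesis using summable_shift_powr[OF that, of "1 + real k"] False by simp
  qed
  have "hurwitz_zeta (1 + real k) p = (\<Sum>m. 1 / (real m + p) ^ Suc k)" if "p > 0" for p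
    unfolding hurwitz_zeta_def
  proof (rule suminf_cong)
    fix m
    show "(real m + p) powr - (1 + real k) = 1 / (real m + p) ^ Suc k"
      using that powr_realpow[of "real m + p" "Suc k"] unfolding powr_minus by (simp add: inverse_eq_divide)
  qed
  then show ?thesis
    using False th s[of \<theta>] s[of "1 - \<theta>"] by (simp add: hurwitz_zeta_diff_def suminf_diff)
next
  case True
  define D where "D m r = (real m + \<theta>) powr - r - (real m + (1 - \<theta>)) powr - r" for m r
  have lim: "(D m \<longlongrightarrow> 1 / (real m + \<theta>) - 1 / (real m + (1 - \<theta>))) (at_right 1)" for m
  proof -
    have "(D m \<longlongrightarrow> (real m + \<theta>) powr - 1 - (real m + (1 - \<theta>)) powr - 1) (at_right 1)"
      unfolding D_def using th by (intro tendsto_intros) auto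
    then show ?thesis using th by (simp add: powr_minus_divide)
  qed
  \<comment> \<open>The mean value theorem gains one power of decay: the two shifts differ by at
    most 1, so the difference is of order m^(-r-1) although each term is of order m^(-r).\<close>
  have mvt: "\<bar>p powr - r - q powr - r\<bar> \<le> r * \<bar>p - q\<bar> * l powr (- r - 1)" if "l > 0" "l \<le> p" "l \<le> q" "r > 0" for p q l r :: real
  proof -
    have *: "\<bar>p powr - r - q powr - r\<bar> \<le> r * \<bar>p - q\<bar> * l powr (- r - 1)" if pq: "p < q" "l > 0" "l \<le> p" "l \<le> q" for p q
    proof -
      obtain \<xi> where xi: "p < \<xi>" "\<xi> < q" "q powr - r - p powr - r = (q - p) * (- r * \<xi> powr (- r - 1))"
        using MVT2[of p q "\<lambda>x. x powr - r" "\<lambda>x. - r * x powr (- r - 1)"] pq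
          has_real_derivative_powr[of _ "- r"] by fastforce
      have "\<xi> powr (- r - 1) \<le> l powr (- r - 1)"
        using xi pq \<open>r > 0\<close> by (intro powr_mono2') auto
      then have "(q - p) * (r * \<xi> powr (- r - 1)) \<le> (q - p) * (r * l powr (- r - 1))"
        using pq \<open>r > 0\<close> by (intro mult_left_mono) auto
      moreover have "\<bar>p powr - r - q powr - r\<bar> = (q - p) * (r * \<xi> powr (- r - 1))"
      proof -
        have "0 \<le> (q - p) * (r * \<xi> powr (- r - 1))" using xi \<open>r > 0\<close> by (intro mult_nonneg_nonneg) auto
        moreover have "q powr - r - p powr - r = - ((q - p) * (r * \<xi> powr (- r - 1)))" using xi(3) by simp
        ultimately show ?thesis by linarith
      qed
      ultimately show ?thesis using pq by (simp add: mult_ac)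
    qed
    show ?thesis
      using *[of p q] *[of q p] that by (cases p q rule: linorder_cases) (auto simp: abs_minus_commute)
  qed
  \<comment> \<open>With \<open>r\<close> between 1 and 2 the factor r is at most 2 and the exponent
    -r - 1 at most -2; \<open>m\<close> at least 1 makes it usable as the positive lower bound
    \<open>l\<close>.\<close>
  have "eventually (\<lambda>(m, r). norm (D m r) \<le> 2 * real m powr - 2) (at_top \<times>\<^sub>F at_right 1)"
    unfolding eventually_prod_filter
  proof (intro exI conjI allI impI)
    show "eventually (\<lambda>m::nat. m \<ge> 1) at_top" by (rule eventually_ge_at_top)
    show "eventually (\<lambda>r::real. 1 < r \<and> r < 2) (at_right 1)"
      by (simp add: eventually_at_right_field) (auto intro: exI[of _ 2])
    fix m :: nat and r :: real assume m: "m \<ge> 1" and r: "1 < r \<and> r < 2"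
    have "\<bar>D m r\<bar> \<le> r * \<bar>(real m + \<theta>) - (real m + (1 - \<theta>))\<bar> * real m powr (- r - 1)"
      unfolding D_def by (rule mvt) (use m r th in auto)
    also have "\<dots> \<le> 2 * 1 * real m powr - 2"
      using m r th by (intro mult_mono powr_mono) auto
    finally show "case (m, r) of (m, r) \<Rightarrow> norm (D m r) \<le> 2 * real m powr - 2" by simp
  qed
  moreover have "summable (\<lambda>m. 2 * real m powr - 2)"
    by (intro summable_mult) (simp add: summable_real_powr_iff)
  ultimately have "((\<lambda>r. \<Sum>m. D m r) \<longlongrightarrow> (\<Sum>m. 1 / (real m + \<theta>) - 1 / (real m + (1 - \<theta>)))) (at_right 1)"
    using tannerys_theorem[OF lim] by auto
  moreover have "eventually (\<lambda>r. (\<Sum>m. D m r) = hurwitz_zeta r \<theta> - hurwitz_zeta r (1 - \<theta>)) (at_right 1)"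
    using eventually_at_right_less[of 1]
  proof eventually_elim
    case (elim r)
    then show ?case unfolding D_def hurwitz_zeta_def
      using th by (intro suminf_diff[symmetric] summable_shift_powr) auto
  qed
  ultimately have "((\<lambda>r. hurwitz_zeta r \<theta> - hurwitz_zeta r (1 - \<theta>)) \<longlongrightarrow> (\<Sum>m. 1 / (real m + \<theta>) - 1 / (real m + (1 - \<theta>)))) (at_right 1)"
    by (rule Lim_transform_eventually)
  then show ?thesis
    using True by (simp add: hurwitz_zeta_diff_def tendsto_Lim)
qed

subsection \<open>Double series\<close>

lemma summable_on_product_nat:
  fixes p q :: "nat \<Rightarrow> real"
  assumes "summable p" "summable q" "\<And>i. p i \<ge> 0" "\<And>j. q j \<ge> 0"
  shows "(\<lambda>(i, j). p i * q j) summable_on UNIV"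
proof -
  have q: "q summable_on UNIV" using assms by (simp add: summable_on_UNIV_nonneg_real_iff)
  have "(\<lambda>(i, j). p i * q j) summable_on UNIV \<times> UNIV"
  proof (rule summable_on_SigmaI)
    show "((\<lambda>y. case (x, y) of (i, j) \<Rightarrow> p i * q j) has_sum p x * infsum q UNIV) UNIV" for x
      using has_sum_cmult_right[OF has_sum_infsum[OF q]] by simp
    have "summable (\<lambda>x. p x * infsum q UNIV)" by (rule summable_mult2[OF assms(1)])
    then show "(\<lambda>x. p x * infsum q UNIV) summable_on UNIV"
      using assms by (subst summable_on_UNIV_nonneg_real_iff) (auto intro!: mult_nonneg_nonneg infsum_nonneg)
  qed (use assms in auto)
  then show ?thesis by simp
qed

lemma summable_on_pair_section:
  fixes f :: "nat \<times> nat \<Rightarrow> 'a::banach"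
  assumes "f summable_on UNIV"
  shows "(\<lambda>j. f (i, j)) summable_on UNIV"
proof -
  have "f summable_on range (Pair i)" by (rule summable_on_subset_banach[OF assms]) simp
  then show ?thesis by (subst (asm) summable_on_reindex) (auto simp: inj_on_def o_def)
qed

lemma infsum_nat_sums:
  fixes f :: "nat \<Rightarrow> 'a::banach"
  assumes "f summable_on UNIV"
  shows "f sums infsum f UNIV"
  using has_sum_imp_sums[OF has_sum_infsum[OF assms]] .

lemma has_sum_difference:
  fixes f g :: "'i \<Rightarrow> 'a::real_normed_vector"
  assumes "(f has_sum a) S" "(g has_sum b) S"
  shows "((\<lambda>x. f x - g x) has_sum (a - b)) S"
  using has_sum_add[OF assms(1), of "\<lambda>x. - g x" "- b"] assms(2) by (simp add: has_sum_uminus)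

lemma iterated_sums:
  fixes f :: "nat \<times> nat \<Rightarrow> 'a::banach"
  assumes f: "f summable_on UNIV"
  shows "(\<lambda>i. \<Sum>j. f (i, j)) sums infsum f UNIV"
proof -
  have "((\<lambda>i. \<Sum>j. f (i, j)) has_sum infsum f UNIV) UNIV"
  proof (rule has_sum_SigmaD[where B = "\<lambda>_. UNIV"])
    show "(f has_sum infsum f UNIV) (Sigma UNIV (\<lambda>_. UNIV))" using f by simp
    show "((\<lambda>j. f (i, j)) has_sum (\<Sum>j. f (i, j))) UNIV" for i
      using has_sum_infsum[OF summable_on_pair_section[OF f]] infsum_nat_sums[OF summable_on_pair_section[OF f]]
      by (simp add: sums_iff)
  qed
  then show ?thesis by (rule has_sum_imp_sums)
qed

lemma summable_on_swap:
  "f summable_on (UNIV :: (nat \<times> nat) set) \<Longrightarrow> (\<lambda>(i, j). f (j, i)) summable_on UNIV"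
  using summable_on_reindex_bij_betw[OF bij_swap, of f] by (simp add: case_prod_unfold prod.swap_def)

lemma infsum_swap_pairs:
  "infsum (\<lambda>(i, j). f (j, i)) (UNIV :: (nat \<times> nat) set) = infsum f UNIV"
  using infsum_reindex_bij_betw[OF bij_swap, of f] by (simp add: case_prod_unfold prod.swap_def)

text \<open>Pairs (i, j) correspond bijectively to pairs (n, d) with d dividing n + 1, through n + 1
  = (i+1)(j+1) and d = i + 1. Unconditional summability permits regrouping along the finite sets of
  divisors; the shifts by one occur because both indices start at 0.\<close>

lemma divisor_sum_sums:
  fixes f :: "nat \<times> nat \<Rightarrow> 'a::banach"
  assumes f: "f summable_on UNIV"
  shows "(\<lambda>n. \<Sum>d | d dvd Suc n. f (d - 1, Suc n div d - 1)) sums infsum f UNIV"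
proof -
  define h where "h = (\<lambda>(n, d). f (d - 1, Suc n div d - 1))"
  define g :: "nat \<times> nat \<Rightarrow> nat \<times> nat" where "g = (\<lambda>(i, j). (Suc i * Suc j - 1, Suc i))"
  have "bij_betw g UNIV (Sigma UNIV (\<lambda>n. {d. d dvd Suc n}))"
  proof (rule bij_betwI[where g = "\<lambda>(n, d). (d - 1, Suc n div d - 1)"])
    show "g \<in> UNIV \<rightarrow> Sigma UNIV (\<lambda>n. {d. d dvd Suc n})"
      by (auto simp: g_def simp del: mult_Suc mult_Suc_right)
    show "(case g x of (n, d) \<Rightarrow> (d - 1, Suc n div d - 1)) = x" for x
      by (cases x) (simp add: g_def del: mult_Suc mult_Suc_right)
    show "g (case y of (n, d) \<Rightarrow> (d - 1, Suc n div d - 1)) = y" if Y: "y \<in> Sigma UNIV (\<lambda>n. {d. d dvd Suc n})" for y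
    proof -
      obtain n d where y: "y = (n, d)" "d dvd Suc n" using Y by auto
      then obtain e where e: "Suc n = d * e" by (elim dvdE)
      then have "d > 0" "e > 0" by (auto intro: Nat.gr0I)
      then show ?thesis using e by (simp add: y(1) g_def del: mult_Suc mult_Suc_right)
    qed
  qed auto
  moreover have "h (g x) = f x" for x
    by (cases x) (simp add: h_def g_def del: mult_Suc mult_Suc_right)
  ultimately have "(h has_sum infsum f UNIV) (Sigma UNIV (\<lambda>n. {d. d dvd Suc n}))"
    using has_sum_reindex_bij_betw[of g UNIV _ h] has_sum_infsum[OF f] by simp
  then have "((\<lambda>n. \<Sum>d | d dvd Suc n. h (n, d)) has_sum infsum f UNIV) UNIV"
    by (rule has_sum_SigmaD) auto
  then show ?thesis
    using has_sum_imp_sums by (simp add: h_def)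
qed

text \<open>With n = d e the argument 2 pi n psi/d becomes 2 pi e psi, so the cosine depends on the
  complementary divisor alone. The divisor sum then unfolds into a double series, which is refolded
  with \<open>e\<close> outside to match \<open>Lambert_transform\<close>.\<close>

lemma divisor_Lambert_sums:
  fixes u \<theta> \<psi> :: real
  assumes u: "u > 0"
  shows "(\<lambda>n. (\<Sum>d | d dvd Suc n. real d ^ k * sin (2 * pi * real d * \<theta>) * cos (2 * pi * real (Suc n) * \<psi> / real d)) * exp (- u * real (Suc n)))
    sums (\<Sum>e. (\<Sum>d. real (Suc d) ^ k * sin (2 * pi * real (Suc d) * \<theta>) * exp (- u * (real (Suc d) * real (Suc e)))) * cos (2 * pi * real (Suc e) * \<psi>))"
proof -
  define f where "f = (\<lambda>(d, e). real (Suc d) ^ k * sin (2 * pi * real (Suc d) * \<theta>) * exp (- u * (real (Suc d) * real (Suc e))) * cos (2 * pi * real (Suc e) * \<psi>))"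
  have fs: "f summable_on UNIV"
  proof (rule abs_summable_summable, rule Infinite_Sum.abs_summable_on_comparison_test')
    have "summable (\<lambda>d. real d ^ k * exp (- u) ^ d)"
      by (rule summable_of_nat_power_times_power) (use u in auto)
    then have "summable (\<lambda>d. real (Suc d) ^ k * exp (- u) ^ Suc d)"
      by (rule summable_Suc_iff[THEN iffD2])
    moreover have "summable (\<lambda>e. exp (- u) ^ e)" using u by (intro summable_geometric) auto
    ultimately show "(\<lambda>(d, e). real (Suc d) ^ k * exp (- u) ^ Suc d * exp (- u) ^ e) summable_on UNIV"
      by (rule summable_on_product_nat) auto
    show "norm (f x) \<le> (case x of (d, e) \<Rightarrow> real (Suc d) ^ k * exp (- u) ^ Suc d * exp (- u) ^ e)" for x
    proof (cases x)
      case (Pair d e)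
      have "real (Suc d) * real (Suc e) \<ge> real (Suc d) + real e" by (simp add: algebra_simps)
      then have "exp (- u * (real (Suc d) * real (Suc e))) \<le> exp (- u * (real (Suc d) + real e))"
        using u by simp
      also have "\<dots> = exp (- u) ^ Suc d * exp (- u) ^ e"
        unfolding exp_of_nat_mult[symmetric] exp_add[symmetric] by (simp add: algebra_simps)
      finally have "exp (- u * (real (Suc d) * real (Suc e))) \<le> exp (- u) ^ Suc d * exp (- u) ^ e" .
      then have "real (Suc d) ^ k * \<bar>sin (2 * pi * real (Suc d) * \<theta>)\<bar> * exp (- u * (real (Suc d) * real (Suc e))) * \<bar>cos (2 * pi * real (Suc e) * \<psi>)\<bar>
          \<le> real (Suc d) ^ k * 1 * (exp (- u) ^ Suc d * exp (- u) ^ e) * 1"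
        by (intro mult_mono) auto
      then show ?thesis by (simp add: Pair f_def abs_mult mult_ac del: of_nat_Suc power_Suc)
    qed
  qed
  have "(\<Sum>d | d dvd Suc n. f (d - 1, Suc n div d - 1)) =
      (\<Sum>d | d dvd Suc n. real d ^ k * sin (2 * pi * real d * \<theta>) * cos (2 * pi * real (Suc n) * \<psi> / real d)) * exp (- u * real (Suc n))" for n
    unfolding sum_distrib_right
  proof (rule sum.cong)
    fix d assume "d \<in> {d. d dvd Suc n}"
    then obtain e where e: "Suc n = d * e" by (auto elim: dvdE)
    then have d: "d > 0" and e0: "e > 0" by (auto intro: Nat.gr0I)
    have "Suc n div d = e" using e d by simp
    moreover have "real (Suc n) = real d * real e" unfolding e by simp
    moreover have "2 * pi * (real d * real e) * \<psi> / real d = 2 * pi * real e * \<psi>" using d by simp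
    ultimately show "f (d - 1, Suc n div d - 1) = real d ^ k * sin (2 * pi * real d * \<theta>) * cos (2 * pi * real (Suc n) * \<psi> / real d) * exp (- u * real (Suc n))"
      using d e0 by (simp only: f_def prod.case Suc_diff_1) (simp only: mult_ac)
  qed simp
  with divisor_sum_sums[OF fs]
  have 1: "(\<lambda>n. (\<Sum>d | d dvd Suc n. real d ^ k * sin (2 * pi * real d * \<theta>) * cos (2 * pi * real (Suc n) * \<psi> / real d)) * exp (- u * real (Suc n)))
    sums infsum f UNIV" by (simp only:)
  have "(\<lambda>e. \<Sum>d. f (d, e)) sums infsum f UNIV"
    using iterated_sums[OF summable_on_swap[OF fs]] by (simp add: infsum_swap_pairs)
  moreover have "(\<Sum>d. f (d, e)) = (\<Sum>d. real (Suc d) ^ k * sin (2 * pi * real (Suc d) * \<theta>) * exp (- u * (real (Suc d) * real (Suc e)))) * cos (2 * pi * real (Suc e) * \<psi>)" for e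
  \<comment> \<open>Summability of the inner series without the cosine factor is obtained by
    dividing by that factor; where it is 0, both sides vanish.\<close>
  proof (cases "cos (2 * pi * real (Suc e) * \<psi>) = 0")
    case False
    have "summable (\<lambda>d. f (d, e))"
      using summable_on_imp_summable[OF summable_on_pair_section[OF summable_on_swap[OF fs], of e]] by simp
    then have "summable (\<lambda>d. f (d, e) / cos (2 * pi * real (Suc e) * \<psi>))" by (rule summable_divide)
    then have "summable (\<lambda>d. real (Suc d) ^ k * sin (2 * pi * real (Suc d) * \<theta>) * exp (- u * (real (Suc d) * real (Suc e))))"
      using False by (simp add: f_def del: of_nat_Suc)
    then show ?thesis unfolding f_def prod.case by (rule suminf_mult2[symmetric])
  qed (simp add: f_def del: of_nat_Suc)
  ultimately have "infsum f UNIV = (\<Sum>e. (\<Sum>d. real (Suc d) ^ k * sin (2 * pi * real (Suc d) * \<theta>) * exp (- u * (real (Suc d) * real (Suc e)))) * cos (2 * pi * real (Suc e) * \<psi>))"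
    by (simp add: sums_iff)
  with 1 show ?thesis by (simp only:)
qed

text \<open>The enumeration \<open>prod_decode\<close> turns the unordered sum over pairs into an
  ordinary series, to which \<open>absolutely_integrable_suminf\<close> applies.\<close>

lemma absolutely_integrable_infsum_pairs:
  fixes f :: "nat \<times> nat \<Rightarrow> real \<Rightarrow> complex"
  assumes S: "S \<in> sets lebesgue" and f: "\<And>p. f p absolutely_integrable_on S"
    and summ: "\<And>x. x \<in> S \<Longrightarrow> (\<lambda>p. f p x) summable_on UNIV"
    and int: "(\<lambda>p. integral S (\<lambda>x. norm (f p x))) summable_on UNIV"
  shows "(\<lambda>x. \<Sum>\<^sub>\<infinity>p. f p x) absolutely_integrable_on S"
    and "integral S (\<lambda>x. \<Sum>\<^sub>\<infinity>p. f p x) = (\<Sum>\<^sub>\<infinity>p. integral S (f p))"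
    and "(\<lambda>p. integral S (f p)) summable_on UNIV"
proof -
  have bij: "bij_betw prod_decode UNIV UNIV" by (rule bij_prod_decode)
  note re = summable_on_reindex_bij_betw[OF bij] infsum_reindex_bij_betw[OF bij]
  have s1: "summable (\<lambda>n. norm (f (prod_decode n) x))" if "x \<in> S" for x
    using summ[OF that] unfolding summable_on_iff_abs_summable_on_complex
    by (intro summable_on_imp_summable) (simp add: re(1)[of "\<lambda>p. norm (f p x)"])
  have s2: "summable (\<lambda>n. integral S (\<lambda>x. norm (f (prod_decode n) x)))"
    using int by (intro summable_on_imp_summable) (simp add: re(1)[of "\<lambda>p. integral S (\<lambda>x. norm (f p x))"])
  note A = absolutely_integrable_suminf[OF S f s1 s2]
  have eq: "(\<Sum>n. f (prod_decode n) x) = (\<Sum>\<^sub>\<infinity>p. f p x)" if "x \<in> S" for x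
    using infsum_nat_sums[of "\<lambda>n. f (prod_decode n) x"] summ[OF that]
    by (simp add: re(1)[of "\<lambda>p. f p x"] re(2)[of "\<lambda>p. f p x"] sums_iff)
  show "(\<lambda>x. \<Sum>\<^sub>\<infinity>p. f p x) absolutely_integrable_on S"
    by (rule absolutely_integrable_spike[OF A(1) negligible_empty]) (use eq in auto)
  have "norm (integral S (f p)) \<le> integral S (\<lambda>x. norm (f p x))" for p
    using f by (intro integral_norm_bound_integral) (auto simp: absolutely_integrable_on_def)
  then show s3: "(\<lambda>p. integral S (f p)) summable_on UNIV"
    by (intro abs_summable_summable[OF Infinite_Sum.abs_summable_on_comparison_test'[OF int]])
  have "(\<lambda>n. integral S (f (prod_decode n))) sums (\<Sum>\<^sub>\<infinity>p. integral S (f p))"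
    using infsum_nat_sums[of "\<lambda>n. integral S (f (prod_decode n))"] s3
    by (simp add: re(1)[of "\<lambda>p. integral S (f p)"] re(2)[of "\<lambda>p. integral S (f p)"])
  then have "(\<Sum>\<^sub>\<infinity>p. integral S (f p)) = integral S (\<lambda>x. \<Sum>n. f (prod_decode n) x)"
    using A(2) sums_unique2 by blast
  also have "\<dots> = integral S (\<lambda>x. \<Sum>\<^sub>\<infinity>p. f p x)"
    by (rule integral_cong) (use eq in auto)
  finally show "integral S (\<lambda>x. \<Sum>\<^sub>\<infinity>p. f p x) = (\<Sum>\<^sub>\<infinity>p. integral S (f p))" ..
qed

subsection \<open>Termwise integration\<close>

text \<open>Since (n+p)(m+q) is at least n q + p m, the exponential is dominated by a product of two
  geometric sequences.\<close>

lemma summable_on_lattice_exp: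
  fixes p q v :: real
  assumes p: "p > 0" and q: "q > 0" and v: "v > 0"
  shows "(\<lambda>(m, n). (real n + p) ^ k * exp (- v * ((real n + p) * (real m + q)))) summable_on UNIV"
proof -
  define r where "r = exp (- v * q)"
  \<comment> \<open>Replacing \<open>p\<close> by an integer \<open>N\<close> above it makes the
    polynomial factor a tail of the series of n^k r^n.\<close>
  obtain N where N: "p \<le> real N" using real_arch_simple by blast
  have r: "0 < r" "r < 1" using v q by (auto simp: r_def)
  have "summable (\<lambda>n. real n ^ k * r ^ n)"
    by (rule summable_of_nat_power_times_power) (use r in auto)
  then have "summable (\<lambda>n. real (n + N) ^ k * r ^ (n + N))" by (rule summable_ignore_initial_segment)
  then have "summable (\<lambda>n. real (n + N) ^ k * r ^ (n + N) * (1 / r ^ N))" by (rule summable_mult2)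
  also have "(\<lambda>n. real (n + N) ^ k * r ^ (n + N) * (1 / r ^ N)) = (\<lambda>n. real (n + N) ^ k * r ^ n)"
    using r by (auto simp: power_add)
  finally have "summable (\<lambda>n. real (n + N) ^ k * r ^ n)" .
  moreover have "summable (\<lambda>m. exp (- v * p) ^ m)" using v p by (intro summable_geometric) auto
  ultimately have s: "(\<lambda>(m, n). exp (- v * p) ^ m * (real (n + N) ^ k * r ^ n)) summable_on UNIV"
    using r by (intro summable_on_product_nat) auto
  show ?thesis
  proof (rule summable_on_comparison_test[OF s])
    fix x :: "nat \<times> nat"
    obtain m n where x: "x = (m, n)" by (cases x)
    have "(real n + p) * (real m + q) \<ge> real n * q + p * real m"
      using p q by (simp add: algebra_simps)
    then have "exp (- v * ((real n + p) * (real m + q))) \<le> exp (- v * (real n * q + p * real m))"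
      using v by simp
    also have "\<dots> = exp (- v * p) ^ m * r ^ n"
      unfolding r_def exp_of_nat_mult[symmetric] exp_add[symmetric] by (simp add: algebra_simps)
    finally have "exp (- v * ((real n + p) * (real m + q))) \<le> exp (- v * p) ^ m * r ^ n" .
    moreover have "(real n + p) ^ k \<le> real (n + N) ^ k" using p N by (intro power_mono) auto
    ultimately have "(real n + p) ^ k * exp (- v * ((real n + p) * (real m + q))) \<le> real (n + N) ^ k * (exp (- v * p) ^ m * r ^ n)"
      by (intro mult_mono) auto
    then show "(case x of (m, n) \<Rightarrow> (real n + p) ^ k * exp (- v * ((real n + p) * (real m + q)))) \<le>
        (case x of (m, n) \<Rightarrow> exp (- v * p) ^ m * (real (n + N) ^ k * r ^ n))"
      by (simp add: x mult_ac)
    show "0 \<le> (case x of (m, n) \<Rightarrow> (real n + p) ^ k * exp (- v * ((real n + p) * (real m + q))))"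
      using p by (simp add: x)
  qed
qed

text \<open>One quarter of the transformed Lambert series. For \<open>v\<close>, \<open>p\<close>,
  \<open>q\<close> positive all terms are positive and summable for every \<open>k\<close>, so at
  this stage the pieces belonging to \<open>\<theta>\<close> and \<open>1 - \<theta>\<close> can be
  handled one at a time.\<close>

definition lattice_theta :: "nat \<Rightarrow> real \<Rightarrow> real \<Rightarrow> real \<Rightarrow> real" where
  "lattice_theta k p q v = (\<Sum>\<^sub>\<infinity>(m, n)\<in>UNIV. (real n + p) ^ k * exp (- v * ((real n + p) * (real m + q))))"

text \<open>Summing over \<open>m\<close> first restores the geometric series behind the kernel.
  Taking \<open>p\<close> as \<open>\<psi>\<close> and as \<open>1 - \<psi>\<close> yields the two
  progressions on the Poisson side.\<close>

lemma sinh_ratio_lattice_sums: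
  assumes v: "v > 0" and th: "0 < \<theta>" "\<theta> < 1" and p: "p > 0"
  shows "(\<lambda>n. (real n + p) ^ k * sinh_ratio v \<theta> (real n + p)) sums (lattice_theta k p \<theta> v - lattice_theta k p (1 - \<theta>) v)"
proof -
  let ?e = "\<lambda>q m n. (real n + p) ^ k * exp (- v * ((real n + p) * (real m + q)))"
  have it: "(\<lambda>n. \<Sum>m. ?e q m n) sums lattice_theta k p q v" "summable (\<lambda>m. ?e q m n)" if "q > 0" for q n
  proof -
    note s = summable_on_swap[OF summable_on_lattice_exp[OF p that v, of k]]
    show "(\<lambda>n. \<Sum>m. ?e q m n) sums lattice_theta k p q v"
      using iterated_sums[OF s] unfolding infsum_swap_pairs by (simp add: lattice_theta_def)
    show "summable (\<lambda>m. ?e q m n)"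
      using summable_on_imp_summable[OF summable_on_pair_section[OF s, of n]] by simp
  qed
  have "(\<Sum>m. ?e \<theta> m n) - (\<Sum>m. ?e (1 - \<theta>) m n) = (real n + p) ^ k * sinh_ratio v \<theta> (real n + p)" for n
  proof -
    have "(\<Sum>m. ?e \<theta> m n) - (\<Sum>m. ?e (1 - \<theta>) m n) = (\<Sum>m. ?e \<theta> m n - ?e (1 - \<theta>) m n)"
      using th by (intro suminf_diff it) auto
    also have "\<dots> = (\<Sum>m. (real n + p) ^ k * (exp (- v * (real m + \<theta>) * (real n + p)) - exp (- v * (real m + (1 - \<theta>)) * (real n + p))))"
      by (simp add: right_diff_distrib mult_ac)
    also have "\<dots> = (real n + p) ^ k * sinh_ratio v \<theta> (real n + p)"
      using sums_mult[OF sinh_ratio_sums[OF v, of "real n + p" \<theta>]] p by (simp add: sums_iff)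
    finally show ?thesis .
  qed
  then show ?thesis
    using sums_diff[OF it(1)[of \<theta>] it(1)[of "1 - \<theta>"]] th by (simp only: diff_gt_0_iff_gt)
qed

text \<open>The weight exp(-t) merges with the lattice exponential into exp(-b t), b = c (n+p)(m+q)
  + 1, which is the origin of the \<open>+ 1\<close> in the denominators; each term is then a scaled
  Gamma integral. The bound on \<open>Re z\<close> makes the resulting double series converge
  absolutely.\<close>

lemma lattice_theta_Mellin:
  fixes p q c :: real and z :: complex
  assumes p: "p > 0" and q: "q > 0" and c: "c > 0" and z: "Re z > real k + 1"
  defines "w \<equiv> \<lambda>(m, n). complex_of_real ((real n + p) ^ k) / complex_of_real (c * ((real n + p) * (real m + q)) + 1) powr z"
  shows "w summable_on UNIV"
    and "(\<lambda>t. of_real t powr (z - 1) * of_real (exp (- t) * lattice_theta k p q (c * t))) absolutely_integrable_on {0<..}"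
    and "integral {0<..} (\<lambda>t. of_real t powr (z - 1) * of_real (exp (- t) * lattice_theta k p q (c * t))) = Gamma z * infsum w UNIV"
proof -
  define R where "R = Re z"
  have R: "R > real k + 1" "Re (of_real R) > 0" and z0: "Re z > 0" using z by (auto simp: R_def)
  define b where "b = (\<lambda>(m, n). c * ((real n + p) * (real m + q)) + 1)"
  have b: "b x > 0" for x using p q c by (auto simp: b_def split: prod.split intro!: add_nonneg_pos mult_nonneg_nonneg)
  define l where "l = (\<lambda>(m::nat, n). (real n + p) ^ k)"
  have l: "l x \<ge> 0" for x using p by (auto simp: l_def split: prod.split)
  define f where "f x t = of_real (l x) * (complex_of_real t powr (z - 1) * of_real (exp (- (b x * t))))" for x t
  have fi: "f x absolutely_integrable_on {0<..}" for x
    unfolding f_def by (intro set_integrable_mult_right Gamma_integral_scaled(1) z0 b)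
  have fI: "integral {0<..} (f x) = Gamma z * w x" for x
  proof -
    have "integral {0<..} (f x) = of_real (l x) * (Gamma z / of_real (b x) powr z)"
      unfolding f_def by (subst integral_mult_right) (simp only: Gamma_integral_scaled(2)[OF z0 b])
    then show ?thesis by (simp add: w_def l_def b_def split: prod.split)
  qed
  have fe: "f x t = (of_real t powr (z - 1) * of_real (exp (- t))) * of_real ((case x of (m, n) \<Rightarrow> (real n + p) ^ k * exp (- (c * t) * ((real n + p) * (real m + q)))))" for x t
  proof -
    obtain m n where x: "x = (m, n)" by (cases x)
    have "- (b x * t) = - t + - (c * t) * ((real n + p) * (real m + q))"
      by (simp add: x b_def algebra_simps)
    then show ?thesis unfolding f_def by (simp only: x l_def prod.case exp_add of_real_mult mult_ac)
  qed
  have le: "(\<lambda>(m, n). (real n + p) ^ k * exp (- (c * t) * ((real n + p) * (real m + q)))) summable_on UNIV" if "t \<in> {0<..}" for t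
    using that c by (intro summable_on_lattice_exp p q) auto
  have summ: "(\<lambda>x. f x t) summable_on UNIV" if "t \<in> {0<..}" for t
    unfolding fe by (intro summable_on_cmult_right summable_on_of_real le that)
  have fsum: "(\<Sum>\<^sub>\<infinity>x. f x t) = of_real t powr (z - 1) * of_real (exp (- t) * lattice_theta k p q (c * t))" if "t \<in> {0<..}" for t
    unfolding fe infsum_cmult_right'
    unfolding infsumI[OF has_sum_of_real[OF has_sum_infsum[OF le[OF that]]]]
    by (simp only: lattice_theta_def of_real_mult mult.assoc)
  \<comment> \<open>The norm of t^(z-1) is t^(R-1), so each L1 norm is again a Gamma integral, with
    the real exponent \<open>R\<close>.\<close>
  have nI: "integral {0<..} (\<lambda>t. norm (f x t)) = Gamma R * (l x / b x powr R)" for x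
  proof -
    have "((\<lambda>t. complex_of_real t powr (of_real R - 1) * of_real (exp (- (b x * t)))) has_integral Gamma (of_real R) / of_real (b x) powr of_real R) {0<..}"
      unfolding has_integral_iff using Gamma_integral_scaled[OF R(2) b] set_lebesgue_integral_eq_integral(1) by blast
    then have "((\<lambda>t. Re (complex_of_real t powr (of_real R - 1) * of_real (exp (- (b x * t))))) has_integral Re (Gamma (of_real R) / of_real (b x) powr of_real R)) {0<..}"
      using has_integral_linear[OF _ bounded_linear_Re] unfolding o_def by blast
    moreover have "Re (Gamma (of_real R) / of_real (b x) powr of_real R) = Gamma R / b x powr R"
    proof -
      have "Gamma (of_real R) / of_real (b x) powr of_real R = complex_of_real (Gamma R / b x powr R)"
        using b[of x] by (simp add: Gamma_complex_of_real powr_of_real)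
      then show ?thesis by (simp only: Re_complex_of_real)
    qed
    moreover have "Re (complex_of_real t powr (of_real R - 1) * of_real (exp (- (b x * t)))) = norm (complex_of_real t powr (z - 1) * of_real (exp (- (b x * t))))" if "t > 0" for t
    proof -
      have "complex_of_real t powr (of_real R - 1) * of_real (exp (- (b x * t))) = complex_of_real (t powr (R - 1) * exp (- (b x * t)))"
      proof -
        have "complex_of_real R - 1 = of_real (R - 1)" by simp
        then show ?thesis using powr_of_real[of t "R - 1"] that by (simp only: of_real_mult less_imp_le)
      qed
      moreover have "norm (complex_of_real t powr (z - 1) * of_real (exp (- (b x * t)))) = t powr (R - 1) * exp (- (b x * t))"
        using that by (simp add: norm_mult norm_powr_real_powr R_def)
      ultimately show ?thesis by (simp only: Re_complex_of_real)
    qed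
    ultimately have "integral {0<..} (\<lambda>t. norm (complex_of_real t powr (z - 1) * of_real (exp (- (b x * t))))) = Gamma R / b x powr R"
      by (subst integral_cong[where g = "\<lambda>t. Re (complex_of_real t powr (of_real R - 1) * of_real (exp (- (b x * t))))"]) (auto simp: integral_unique)
    moreover have "norm (f x t) = l x * norm (complex_of_real t powr (z - 1) * of_real (exp (- (b x * t))))" for t
      using l[of x] unfolding f_def norm_mult[of "of_real (l x)"] norm_of_real by simp
    ultimately show ?thesis by (simp add: mult_ac)
  qed
  have "(\<lambda>x. l x / b x powr R) summable_on UNIV"
  proof (rule summable_on_comparison_test)
    have "summable (\<lambda>m. c powr - R * (real m + q) powr - R)"
      using R q by (intro summable_mult summable_shift_powr) auto
    moreover have "summable (\<lambda>n. (real n + p) powr - (R - real k))"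
      using R p by (intro summable_shift_powr) auto
    ultimately show "(\<lambda>(m, n). c powr - R * (real m + q) powr - R * (real n + p) powr - (R - real k)) summable_on UNIV"
      by (rule summable_on_product_nat) auto
    show "0 \<le> l x / b x powr R" for x using l[of x] b[of x] by simp
    show "l x / b x powr R \<le> (case x of (m, n) \<Rightarrow> c powr - R * (real m + q) powr - R * (real n + p) powr - (R - real k))" for x
    proof (cases x)
      case (Pair m n)
      have pos: "c * ((real n + p) * (real m + q)) > 0" using c p q by (intro mult_pos_pos add_nonneg_pos) auto
      \<comment> \<open>Dropping the \<open>+ 1\<close> in \<open>b\<close> lets the bound factor,
        with exponents -R in \<open>m\<close> and -(R - k) in \<open>n\<close>; both R and R - k
        exceed 1.\<close>
      have "l x / b x powr R \<le> (real n + p) ^ k / (c * ((real n + p) * (real m + q))) powr R"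
        using pos p R unfolding Pair l_def b_def prod.case by (intro divide_left_mono powr_mono2 mult_pos_pos) auto
      also have "(real n + p) ^ k = (real n + p) powr real k" using p by (intro powr_realpow[symmetric]) auto
      also have "(real n + p) powr real k / (c * ((real n + p) * (real m + q))) powr R =
          c powr - R * (real m + q) powr - R * (real n + p) powr - (R - real k)"
      proof -
        have "\<gamma> powr real k / (c * (\<gamma> * \<beta>)) powr R = c powr - R * \<beta> powr - R * \<gamma> powr - (R - real k)"
          if "\<gamma> > 0" "\<beta> > 0" for \<gamma> \<beta>
          using c that by (simp add: powr_mult powr_minus powr_diff field_simps)
        then show ?thesis using p q by (simp add: add_nonneg_pos)
      qed
      finally show ?thesis by (simp add: Pair)
    qed
  qed
  then have int: "(\<lambda>x. integral {0<..} (\<lambda>t. norm (f x t))) summable_on UNIV"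
    unfolding nI by (rule summable_on_cmult_right)
  note A = absolutely_integrable_infsum_pairs[OF _ fi summ int, simplified]
  \<comment> \<open>Integration yields summability of Gamma(z) times \<open>w\<close>; that of
    \<open>w\<close> itself follows because Gamma has no zeros.\<close>
  have G: "Gamma z \<noteq> 0" using z0 by (auto simp: Gamma_eq_zero_iff elim!: nonpos_Ints_cases)
  show "w summable_on UNIV"
    using summable_on_cmult_right[OF A(3), of "inverse (Gamma z)"] G by (simp add: fI mult.assoc[symmetric])
  show "(\<lambda>t. of_real t powr (z - 1) * of_real (exp (- t) * lattice_theta k p q (c * t))) absolutely_integrable_on {0<..}"
    by (rule absolutely_integrable_spike[OF A(1) negligible_empty]) (use fsum in auto)
  have "integral {0<..} (\<lambda>t. of_real t powr (z - 1) * of_real (exp (- t) * lattice_theta k p q (c * t))) = integral {0<..} (\<lambda>t. \<Sum>\<^sub>\<infinity>x. f x t)"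
    by (rule integral_cong) (use fsum in auto)
  also have "\<dots> = Gamma z * infsum w UNIV"
    unfolding A(2) fI by (rule infsum_cmult_right')
  finally show "integral {0<..} (\<lambda>t. of_real t powr (z - 1) * of_real (exp (- t) * lattice_theta k p q (c * t))) = Gamma z * infsum w UNIV" .
qed

text \<open>\<open>besselK_Mellin\<close> with c = n X, summed under the integral. The coefficients
  may grow like n^(k+1), so exp(-n X/t) is bounded by a multiple of (t/n)^(k+3): two powers more
  than the growth leave the summable factor 1/n^2.\<close>

lemma besselK_series_integral:
  fixes A :: "nat \<Rightarrow> real" and \<nu> :: complex
  assumes \<nu>: "Re \<nu> > 0" and X: "X > 0" and A: "\<And>n. \<bar>A n\<bar> \<le> real (Suc n) ^ Suc k"
  shows "of_real X powr (\<nu> / 2) * (\<Sum>n. of_nat (Suc n) powr (\<nu> / 2) * besselK \<nu> (2 * sqrt (real (Suc n) * X)) * complex_of_real (A n)) =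
    1 / 2 * integral {0<..} (\<lambda>t. of_real t powr (\<nu> - 1) * of_real (exp (- t) * (\<Sum>n. A n * exp (- (X / t) * real (Suc n)))))"
proof -
  define f where "f n t = of_real (A n) * (complex_of_real t powr (\<nu> - 1) * of_real (exp (- t - real (Suc n) * X / t)))" for n t
  \<comment> \<open>The power t^(k+3) spent on the decay in n raises the exponent of the Gamma
    integrand, which remains integrable.\<close>
  define h where "h t = complex_of_real t powr ((\<nu> + of_nat (k + 3)) - 1) * of_real (exp (- (1 * t)))" for t
  define D where "D = fact (k + 3) / X ^ (k + 3)"
  have D: "D \<ge> 0" using X by (simp add: D_def)
  have X': "real (Suc n) * X > 0" for n using X by simp
  have hi: "h absolutely_integrable_on {0<..}"
    unfolding h_def using \<nu> by (intro Gamma_integral_scaled(1)) auto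
  have fi: "f n absolutely_integrable_on {0<..}" for n
    unfolding f_def by (intro set_integrable_mult_right besselK_Mellin(1) \<nu> X')
  have fI: "integral {0<..} (f n) = 2 * (of_real X powr (\<nu> / 2) * (of_nat (Suc n) powr (\<nu> / 2) * besselK \<nu> (2 * sqrt (real (Suc n) * X)) * complex_of_real (A n)))" for n
  proof -
    have "complex_of_real (real (Suc n) * X) powr (\<nu> / 2) = of_nat (Suc n) powr (\<nu> / 2) * of_real X powr (\<nu> / 2)"
      using X by (simp add: powr_times_real del: of_nat_Suc)
    moreover have "integral {0<..} (f n) = of_real (A n) * (2 * of_real (real (Suc n) * X) powr (\<nu> / 2) * besselK \<nu> (2 * sqrt (real (Suc n) * X)))"
      unfolding f_def besselK_Mellin(2)[OF \<nu> X', symmetric] by (rule integral_mult_right)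
    ultimately show ?thesis by (simp only: mult_ac)
  qed
  have fb: "norm (f n t) \<le> D * (1 / real (Suc n) ^ 2) * norm (h t)" if t: "t > 0" for n t
  proof -
    define y where "y = real (Suc n) * X / t"
    have y: "y > 0" using X t by (simp add: y_def)
    have "exp (- y) \<le> fact (k + 3) / y ^ (k + 3)"
      using power_le_fact_exp[of y "k + 3"] y by (simp add: exp_minus field_simps)
    also have "\<dots> = D * t ^ (k + 3) / real (Suc n) ^ (k + 3)"
      using X t by (simp add: y_def D_def power_mult_distrib power_divide field_simps del: of_nat_Suc)
    finally have e: "exp (- y) \<le> D * t ^ (k + 3) / real (Suc n) ^ (k + 3)" .
    have "norm (f n t) = \<bar>A n\<bar> * exp (- y) * (norm (complex_of_real t powr (\<nu> - 1)) * exp (- t))"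
    proof -
      have "exp (- t - real (Suc n) * X / t) = exp (- y) * exp (- t)"
        by (simp add: y_def exp_add[symmetric])
      then show ?thesis by (simp only: f_def norm_mult norm_of_real abs_mult abs_exp_cancel mult_ac)
    qed
    also have "\<dots> \<le> real (Suc n) ^ Suc k * (D * t ^ (k + 3) / real (Suc n) ^ (k + 3)) * (norm (complex_of_real t powr (\<nu> - 1)) * exp (- t))"
      using A e by (intro mult_right_mono mult_mono) auto
    also have "\<dots> = D * (real (Suc n) ^ Suc k / real (Suc n) ^ (k + 3)) * (t ^ (k + 3) * norm (complex_of_real t powr (\<nu> - 1)) * exp (- t))"
      by simp
    also have "real (Suc n) ^ Suc k / real (Suc n) ^ (k + 3) = 1 / real (Suc n) ^ 2"
    proof -
      have "real (Suc n) ^ (k + 3) = real (Suc n) ^ Suc k * real (Suc n) ^ 2"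
        by (simp add: power_add[symmetric] numeral_eq_Suc del: of_nat_Suc)
      then show ?thesis by (simp del: of_nat_Suc power_Suc)
    qed
    also have "t ^ (k + 3) * norm (complex_of_real t powr (\<nu> - 1)) = norm (complex_of_real t powr ((\<nu> + of_nat (k + 3)) - 1))"
    proof -
      have "complex_of_real t powr ((\<nu> + of_nat (k + 3)) - 1) = of_real t powr of_nat (k + 3) * of_real t powr (\<nu> - 1)"
        unfolding powr_add[symmetric] by (simp add: algebra_simps)
      also have "complex_of_real t powr of_nat (k + 3) = of_real t ^ (k + 3)"
        using t by (intro powr_nat') auto
      finally show ?thesis using t by (simp add: norm_mult norm_power del: of_nat_add)
    qed
    finally show ?thesis by (simp add: h_def norm_mult)
  qed
  have s2: "summable (\<lambda>n. D * (1 / real (Suc n) ^ 2))"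
    using inverse_squares_sums by (intro summable_mult) (simp add: sums_iff)
  have summ: "summable (\<lambda>n. norm (f n t))" if "t \<in> {0<..}" for t
    by (rule summable_comparison_test[OF _ summable_mult2[OF s2]]) (use fb that in auto)
  have int: "summable (\<lambda>n. integral {0<..} (\<lambda>t. norm (f n t)))"
  proof (rule summable_comparison_test[OF _ summable_mult2[OF s2]], intro exI allI impI)
    fix n
    have "integral {0<..} (\<lambda>t. norm (f n t)) \<le> integral {0<..} (\<lambda>t. D * (1 / real (Suc n) ^ 2) * norm (h t))"
      using fi hi fb by (intro integral_le) (auto simp: absolutely_integrable_on_def intro!: integrable_on_mult_right)
    moreover have "0 \<le> integral {0<..} (\<lambda>t. norm (f n t))"
      using fi by (intro integral_nonneg) (auto simp: absolutely_integrable_on_def)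
    ultimately show "norm (integral {0<..} (\<lambda>t. norm (f n t))) \<le> D * (1 / real (Suc n) ^ 2) * integral {0<..} (\<lambda>t. norm (h t))"
      by simp
  qed
  have sums: "(\<lambda>n. integral {0<..} (f n)) sums integral {0<..} (\<lambda>t. \<Sum>n. f n t)"
    by (rule absolutely_integrable_suminf(2)[OF _ fi summ int]) auto
  have X0: "complex_of_real X powr (\<nu> / 2) \<noteq> 0" using X by simp
  have eq: "(\<Sum>n. f n t) = of_real t powr (\<nu> - 1) * of_real (exp (- t) * (\<Sum>n. A n * exp (- (X / t) * real (Suc n))))" if t: "t > 0" for t
  proof -
    have ft: "f n t = (of_real t powr (\<nu> - 1) * of_real (exp (- t))) * of_real (A n * exp (- (X / t) * real (Suc n)))" for n
    proof -
      have "- t - real (Suc n) * X / t = - t + - (X / t) * real (Suc n)" by simp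
      then show ?thesis unfolding f_def by (simp only: exp_add of_real_mult mult_ac)
    qed
    have ne: "complex_of_real t powr (\<nu> - 1) * of_real (exp (- t)) \<noteq> 0" using t by simp
    have "summable (\<lambda>n. f n t)" by (rule summable_norm_cancel[OF summ]) (use t in simp)
    then have "summable (\<lambda>n. f n t / (of_real t powr (\<nu> - 1) * of_real (exp (- t))))" by (rule summable_divide)
    then have sc: "summable (\<lambda>n. complex_of_real (A n * exp (- (X / t) * real (Suc n))))"
      unfolding ft using ne by simp
    then have "summable (\<lambda>n. A n * exp (- (X / t) * real (Suc n)))" unfolding summable_complex_of_real .
    then have "(\<Sum>n. complex_of_real (A n * exp (- (X / t) * real (Suc n)))) = of_real (\<Sum>n. A n * exp (- (X / t) * real (Suc n)))"
      by (rule suminf_of_real[symmetric])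
    then show ?thesis unfolding ft suminf_mult[OF sc] by (simp only: of_real_mult mult.assoc)
  qed
  have "integral {0<..} (\<lambda>t. \<Sum>n. f n t) = integral {0<..} (\<lambda>t. of_real t powr (\<nu> - 1) * of_real (exp (- t) * (\<Sum>n. A n * exp (- (X / t) * real (Suc n)))))"
    by (rule integral_cong) (use eq in auto)
  with sums have S: "(\<lambda>n. integral {0<..} (f n)) sums integral {0<..} (\<lambda>t. of_real t powr (\<nu> - 1) * of_real (exp (- t) * (\<Sum>n. A n * exp (- (X / t) * real (Suc n)))))"
    by simp
  have "(\<lambda>n. 1 / (2 * of_real X powr (\<nu> / 2)) * integral {0<..} (f n)) = (\<lambda>n. of_nat (Suc n) powr (\<nu> / 2) * besselK \<nu> (2 * sqrt (real (Suc n) * X)) * complex_of_real (A n))"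
    unfolding fI using X0 by (simp add: fun_eq_iff del: of_nat_Suc)
  with sums_mult[OF S, of "1 / (2 * of_real X powr (\<nu> / 2))"]
  have "(\<lambda>n. of_nat (Suc n) powr (\<nu> / 2) * besselK \<nu> (2 * sqrt (real (Suc n) * X)) * complex_of_real (A n)) sums
     (1 / (2 * of_real X powr (\<nu> / 2)) * integral {0<..} (\<lambda>t. of_real t powr (\<nu> - 1) * of_real (exp (- t) * (\<Sum>n. A n * exp (- (X / t) * real (Suc n))))))"
    by simp
  then show ?thesis using X0 by (simp only: sums_iff) simp
qed

section \<open>Integration of the transformed Lambert series and comparison of constants\<close>

theorem theorem2p16:
  fixes a x \<theta> \<psi> :: real and k :: nat and \<nu> :: complex
  assumes "a > 0" and "x > 0" and "0 < \<theta>" and "\<theta> < 1" and "0 < \<psi>" and "\<psi> < 1"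
    and "even k" and "Re \<nu> > 0"
  shows "complex_of_real (a^2 * x / 4) powr (\<nu> / 2 + of_nat k + 1) *
      (\<Sum>n. (of_nat (Suc n) powr (\<nu> / 2)) * besselK \<nu> (a * sqrt (real (Suc n) * x)) *
         complex_of_real (\<Sum>d\<in>{d. d dvd Suc n}. real d ^ k * sin (2 * pi * real d * \<theta>)
                                * cos (2 * pi * real (Suc n) * \<psi> / real d)))
    = - complex_of_real ((-1) ^ (k div 2) * a ^ (2 * k + 2) * fact k
            / (2 ^ (2 * k + 4) * (2 * pi) ^ (k + 1))) * Gamma \<nu>
        * complex_of_real (hurwitz_zeta_diff (1 + real k) \<theta> * x ^ (k + 1))
      + complex_of_real ((-1) ^ (k div 2) * (2 * pi) ^ (k + 1) / 8) * Gamma (\<nu> + of_nat k + 1)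
        * (\<Sum>\<^sub>\<infinity>(m, n) \<in> (UNIV :: (nat \<times> nat) set).
             complex_of_real ((real n + \<psi>) ^ k)
               / complex_of_real (16 * pi^2 / a^2 * ((real n + \<psi>) * (real m + \<theta>)) / x + 1)
                   powr (\<nu> + of_nat k + 1)
           + complex_of_real ((real n + 1 - \<psi>) ^ k)
               / complex_of_real (16 * pi^2 / a^2 * ((real n + 1 - \<psi>) * (real m + \<theta>)) / x + 1)
                   powr (\<nu> + of_nat k + 1)
           - complex_of_real ((real n + 1 - \<psi>) ^ k)
               / complex_of_real (16 * pi^2 / a^2 * ((real n + 1 - \<psi>) * (real m + 1 - \<theta>)) / x + 1)
                   powr (\<nu> + of_nat k + 1)
           - complex_of_real ((real n + \<psi>) ^ k)
               / complex_of_real (16 * pi^2 / a^2 * ((real n + \<psi>) * (real m + 1 - \<theta>)) / x + 1)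
                   powr (\<nu> + of_nat k + 1))"
proof -
  define X where "X = a\<^sup>2 * x / 4"
  \<comment> \<open>Chosen so that v = c t belongs to u = X/t, that is u v = 4 pi^2; it equals 16
    pi^2/(a^2 x), the constant in the denominators of the claim.\<close>
  define c where "c = 4 * pi\<^sup>2 / X"
  define s where "s = (-1 :: real) ^ (k div 2)"
  define z where "z = \<nu> + of_nat k + 1"
  define A where "A n = (\<Sum>d\<in>{d. d dvd Suc n}. real d ^ k * sin (2 * pi * real d * \<theta>)
      * cos (2 * pi * real (Suc n) * \<psi> / real d))" for n
  define Z where "Z = (\<Sum>m. 1 / (real m + \<theta>) ^ Suc k - 1 / (real m + (1 - \<theta>)) ^ Suc k)"
  define W where "W p q = (\<Sum>\<^sub>\<infinity>(m, n)\<in>(UNIV :: (nat \<times> nat) set).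
      complex_of_real ((real n + p) ^ k) / complex_of_real (c * ((real n + p) * (real m + q)) + 1) powr z)" for p q
  define T where "T p q t = lattice_theta k p q (c * t)" for p q t
  define S where "S = W \<psi> \<theta> + W (1 - \<psi>) \<theta> - W (1 - \<psi>) (1 - \<theta>) - W \<psi> (1 - \<theta>)"
  have X: "X > 0" and c: "c > 0" using assms by (auto simp: X_def c_def)
  have z: "Re z > real k + 1" using assms by (simp add: z_def)
  have th: "0 < \<theta>" "\<theta> < 1" "0 < 1 - \<theta>" and ps: "0 < \<psi>" "0 < 1 - \<psi>" "\<psi> \<in> {0..1}" using assms by auto
  have cc: "16 * pi\<^sup>2 / a\<^sup>2 * y / x = c * y" for y
    using assms by (simp add: c_def X_def field_simps)
  have sq: "a * sqrt (real (Suc n) * x) = 2 * sqrt (real (Suc n) * X)" for n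
  proof -
    have "real (Suc n) * X = (a / 2)\<^sup>2 * (real (Suc n) * x)" by (simp add: X_def power_divide)
    then have "sqrt (real (Suc n) * X) = a / 2 * sqrt (real (Suc n) * x)"
      using assms by (simp only: real_sqrt_mult[of "(a / 2)\<^sup>2"] real_sqrt_abs)
    then show ?thesis by simp
  qed
  \<comment> \<open>There are at most n + 1 divisors, each contributing at most (n+1)^k: the growth
    allowed in \<open>besselK_series_integral\<close>.\<close>
  have A: "\<bar>A n\<bar> \<le> real (Suc n) ^ Suc k" for n
  proof -
    have sub: "{d. d dvd Suc n} \<subseteq> {1..Suc n}" using dvd_imp_le[of _ "Suc n"] dvd_pos_nat[of "Suc n"] by (auto simp: Suc_le_eq)
    have "\<bar>A n\<bar> \<le> (\<Sum>d\<in>{d. d dvd Suc n}. real (Suc n) ^ k)"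
      unfolding A_def
    proof (rule order_trans[OF sum_abs sum_mono])
      fix d assume "d \<in> {d. d dvd Suc n}"
      then have "real d \<le> real (Suc n)" using sub by auto
      then have "real d ^ k * \<bar>sin (2 * pi * real d * \<theta>)\<bar> * \<bar>cos (2 * pi * real (Suc n) * \<psi> / real d)\<bar> \<le> real (Suc n) ^ k * 1 * 1"
        by (intro mult_mono power_mono) auto
      then show "\<bar>real d ^ k * sin (2 * pi * real d * \<theta>) * cos (2 * pi * real (Suc n) * \<psi> / real d)\<bar> \<le> real (Suc n) ^ k"
        by (simp add: abs_mult)
    qed
    also have "\<dots> = real (card {d. d dvd Suc n}) * real (Suc n) ^ k" by simp
    also have "\<dots> \<le> real (Suc n) * real (Suc n) ^ k"
      using card_mono[OF _ sub] by (intro mult_right_mono) auto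
    finally show ?thesis by simp
  qed
  \<comment> \<open>\<open>Lambert_transform\<close> at v = c t, solved for the Lambert series. As s
    is 1 or -1, dividing by it is the same as multiplying by it.\<close>
  have F: "(\<Sum>n. A n * exp (- (X / t) * real (Suc n))) =
      s / (2 * pi) ^ Suc k * ((c * t) ^ Suc k / 4 * (T \<psi> \<theta> t + T (1 - \<psi>) \<theta> t - T (1 - \<psi>) (1 - \<theta>) t - T \<psi> (1 - \<theta>) t) - fact k * Z / 2)"
    (is "?F = _") if t: "t > 0" for t
  proof -
    have v: "c * t > 0" and u: "X / t > 0" using c X t by auto
    have uv: "4 * pi\<^sup>2 / (c * t) = X / t" using X by (simp add: c_def)
    have ss: "s * s = 1" by (simp add: s_def flip: power_add)
    have "?F = (\<Sum>e. (\<Sum>d. real (Suc d) ^ k * sin (2 * pi * real (Suc d) * \<theta>) * exp (- (X / t) * (real (Suc d) * real (Suc e)))) * cos (2 * pi * real (Suc e) * \<psi>))"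
      using divisor_Lambert_sums[OF u] unfolding A_def by (rule sums_unique[symmetric])
    moreover have "(\<lambda>n. (real n + \<psi>) ^ k * sinh_ratio (c * t) \<theta> (real n + \<psi>) + (real n + 1 - \<psi>) ^ k * sinh_ratio (c * t) \<theta> (real n + 1 - \<psi>))
        sums (T \<psi> \<theta> t - T \<psi> (1 - \<theta>) t + (T (1 - \<psi>) \<theta> t - T (1 - \<psi>) (1 - \<theta>) t))"
      using sums_add[OF sinh_ratio_lattice_sums[OF v th(1,2) ps(1)] sinh_ratio_lattice_sums[OF v th(1,2) ps(2)]]
      by (simp only: T_def add_diff_eq)
    ultimately have "T \<psi> \<theta> t - T \<psi> (1 - \<theta>) t + (T (1 - \<psi>) \<theta> t - T (1 - \<psi>) (1 - \<theta>) t) =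
        2 * fact k / (c * t) ^ Suc k * Z + 4 * (2 * pi) ^ Suc k * s / (c * t) ^ Suc k * ?F"
      using Lambert_transform(1)[OF v th(1,2) ps(3) \<open>even k\<close>] unfolding uv Z_def s_def by (simp only: sums_iff)
    then have "T \<psi> \<theta> t + T (1 - \<psi>) \<theta> t - T (1 - \<psi>) (1 - \<theta>) t - T \<psi> (1 - \<theta>) t =
        2 * fact k / (c * t) ^ Suc k * Z + 4 * (2 * pi) ^ Suc k * s / (c * t) ^ Suc k * ?F" by linarith
    \<comment> \<open>Letters stand for the powers, so that clearing denominators does not expand
      them.\<close>
    moreover have "D / 4 * P - f * Z / 2 = p * s * G" if "P = 2 * f / D * Z + 4 * p * s / D * G" "D > 0" for D P f p G
      using that by (simp add: field_simps)
    ultimately have "(c * t) ^ Suc k / 4 * (T \<psi> \<theta> t + T (1 - \<psi>) \<theta> t - T (1 - \<psi>) (1 - \<theta>) t - T \<psi> (1 - \<theta>) t) - fact k * Z / 2 =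
        (2 * pi) ^ Suc k * s * ?F"
      using zero_less_power[OF v] by blast
    then have "s / (2 * pi) ^ Suc k * ((c * t) ^ Suc k / 4 * (T \<psi> \<theta> t + T (1 - \<psi>) \<theta> t - T (1 - \<psi>) (1 - \<theta>) t - T \<psi> (1 - \<theta>) t) - fact k * Z / 2) =
        s / (2 * pi) ^ Suc k * ((2 * pi) ^ Suc k * s * ?F)" by (simp only:)
    also have "\<dots> = (s * s) * ?F" by simp
    finally show ?thesis by (simp add: ss)
  qed
  define K1 K2 where "K1 = complex_of_real (s / (2 * pi) ^ Suc k * (c ^ Suc k / 4))"
    and "K2 = complex_of_real (s / (2 * pi) ^ Suc k * (fact k * Z / 2))"
  have hT: "((\<lambda>t. of_real t powr (z - 1) * of_real (exp (- t) * T p q t)) has_integral Gamma z * W p q) {0<..}"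
    if "p > 0" "q > 0" for p q
    unfolding has_integral_iff T_def W_def
    using lattice_theta_Mellin(2,3)[OF that c z] set_lebesgue_integral_eq_integral(1) by blast
  have hG: "((\<lambda>t. of_real t powr (\<nu> - 1) * of_real (exp (- (1 * t)))) has_integral Gamma \<nu>) {0<..}"
    unfolding has_integral_iff
    using Gamma_integral_scaled[OF \<open>Re \<nu> > 0\<close>, of 1] set_lebesgue_integral_eq_integral(1) by auto
  have "((\<lambda>t. K1 * (of_real t powr (z - 1) * of_real (exp (- t) * T \<psi> \<theta> t) + of_real t powr (z - 1) * of_real (exp (- t) * T (1 - \<psi>) \<theta> t)
       - of_real t powr (z - 1) * of_real (exp (- t) * T (1 - \<psi>) (1 - \<theta>) t) - of_real t powr (z - 1) * of_real (exp (- t) * T \<psi> (1 - \<theta>) t))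
       - K2 * (of_real t powr (\<nu> - 1) * of_real (exp (- (1 * t)))))
     has_integral K1 * (Gamma z * W \<psi> \<theta> + Gamma z * W (1 - \<psi>) \<theta> - Gamma z * W (1 - \<psi>) (1 - \<theta>) - Gamma z * W \<psi> (1 - \<theta>)) - K2 * Gamma \<nu>) {0<..}"
    by (intro has_integral_diff has_integral_add has_integral_mult_right hT hG th ps)
  then have "((\<lambda>t. of_real t powr (\<nu> - 1) * of_real (exp (- t) * (\<Sum>n. A n * exp (- (X / t) * real (Suc n)))))
     has_integral K1 * (Gamma z * W \<psi> \<theta> + Gamma z * W (1 - \<psi>) \<theta> - Gamma z * W (1 - \<psi>) (1 - \<theta>) - Gamma z * W \<psi> (1 - \<theta>)) - K2 * Gamma \<nu>) {0<..}"
  proof (rule has_integral_eq[rotated])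
    fix t :: real assume "t \<in> {0<..}"
    then have t: "t > 0" by simp
    \<comment> \<open>Of the factor (c t)^(k+1) before the lattice series, t^(k+1) raises the
      exponent from nu - 1 to z - 1, while c^(k+1) sits in \<open>K1\<close>. The zeta term has no
      such factor and keeps nu - 1.\<close>
    have "z - 1 = \<nu> - 1 + of_nat (Suc k)" by (simp add: z_def)
    moreover have "complex_of_real t powr of_nat (Suc k) = of_real (t ^ Suc k)"
      using t by (subst powr_complexpow) auto
    ultimately have pz: "complex_of_real t powr (z - 1) = of_real t powr (\<nu> - 1) * of_real (t ^ Suc k)"
      by (simp only: powr_add)
    show "K1 * (of_real t powr (z - 1) * of_real (exp (- t) * T \<psi> \<theta> t) + of_real t powr (z - 1) * of_real (exp (- t) * T (1 - \<psi>) \<theta> t)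
       - of_real t powr (z - 1) * of_real (exp (- t) * T (1 - \<psi>) (1 - \<theta>) t) - of_real t powr (z - 1) * of_real (exp (- t) * T \<psi> (1 - \<theta>) t))
       - K2 * (of_real t powr (\<nu> - 1) * of_real (exp (- (1 * t))))
      = of_real t powr (\<nu> - 1) * of_real (exp (- t) * (\<Sum>n. A n * exp (- (X / t) * real (Suc n))))"
      unfolding F[OF t] pz K1_def K2_def power_mult_distrib[of c t]
      by (simp only: mult_1_left of_real_mult of_real_add of_real_diff of_real_divide) (simp add: algebra_simps)
  qed
  then have I: "integral {0<..} (\<lambda>t. of_real t powr (\<nu> - 1) * of_real (exp (- t) * (\<Sum>n. A n * exp (- (X / t) * real (Suc n)))))
     = K1 * (Gamma z * S) - K2 * Gamma \<nu>"
    by (simp add: integral_unique S_def right_diff_distrib distrib_left)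
  have "((\<lambda>(m, n). complex_of_real ((real n + p) ^ k) / complex_of_real (c * ((real n + p) * (real m + q)) + 1) powr z) has_sum W p q) UNIV"
    if "p > 0" "q > 0" for p q
    unfolding W_def by (intro has_sum_infsum lattice_theta_Mellin(1) that c z)
  note this[OF ps(1) th(1)] this[OF ps(2) th(1)] this[OF ps(2) th(3)] this[OF ps(1) th(3)]
  from has_sum_difference[OF has_sum_difference[OF has_sum_add[OF this(1,2)] this(3)] this(4)]
  have S: "(\<Sum>\<^sub>\<infinity>(m, n) \<in> (UNIV :: (nat \<times> nat) set).
             complex_of_real ((real n + \<psi>) ^ k)
               / complex_of_real (16 * pi^2 / a^2 * ((real n + \<psi>) * (real m + \<theta>)) / x + 1)
                   powr (\<nu> + of_nat k + 1)
           + complex_of_real ((real n + 1 - \<psi>) ^ k)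
               / complex_of_real (16 * pi^2 / a^2 * ((real n + 1 - \<psi>) * (real m + \<theta>)) / x + 1)
                   powr (\<nu> + of_nat k + 1)
           - complex_of_real ((real n + 1 - \<psi>) ^ k)
               / complex_of_real (16 * pi^2 / a^2 * ((real n + 1 - \<psi>) * (real m + 1 - \<theta>)) / x + 1)
                   powr (\<nu> + of_nat k + 1)
           - complex_of_real ((real n + \<psi>) ^ k)
               / complex_of_real (16 * pi^2 / a^2 * ((real n + \<psi>) * (real m + 1 - \<theta>)) / x + 1)
                   powr (\<nu> + of_nat k + 1)) = S"
    unfolding S_def by (intro infsumI) (simp only: case_prod_unfold cc add_diff_eq z_def)
  have "complex_of_real X powr (\<nu> / 2 + of_nat k + 1) = of_real (X ^ Suc k) * of_real X powr (\<nu> / 2)"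
  proof -
    have "\<nu> / 2 + of_nat k + 1 = of_nat (Suc k) + \<nu> / 2" by simp
    moreover have "complex_of_real X powr of_nat (Suc k) = of_real (X ^ Suc k)"
      using X by (subst powr_complexpow) auto
    ultimately show ?thesis by (simp only: powr_add)
  qed
  then have "complex_of_real X powr (\<nu> / 2 + of_nat k + 1) *
      (\<Sum>n. of_nat (Suc n) powr (\<nu> / 2) * besselK \<nu> (2 * sqrt (real (Suc n) * X)) * complex_of_real (A n))
    = of_real (X ^ Suc k) * (1 / 2 * (K1 * (Gamma z * S) - K2 * Gamma \<nu>))"
    using besselK_series_integral[OF \<open>Re \<nu> > 0\<close> X A] by (simp only: I mult.assoc)
  also have "\<dots> = of_real (X ^ Suc k / 2) * K1 * Gamma z * S - of_real (X ^ Suc k / 2) * K2 * Gamma \<nu>"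
    by (simp add: algebra_simps)
  \<comment> \<open>From X c = (2 pi)^2 the powers leave (2 pi)^(2k+2), of which \<open>K1\<close>
    divides out one half; 8 is 2 from the Bessel integral times 4 from Poisson summation.\<close>
  also have "of_real (X ^ Suc k / 2) * K1 = complex_of_real (s * (2 * pi) ^ (k + 1) / 8)"
  proof -
    have "X * c = 4 * pi\<^sup>2" using X by (simp add: c_def)
    then have "X ^ Suc k * c ^ Suc k = (4 * pi\<^sup>2) ^ Suc k" by (metis power_mult_distrib)
    also have "4 * pi\<^sup>2 = (2 * pi) * (2 * pi)" by (simp add: power2_eq_square)
    also have "\<dots> ^ Suc k = (2 * pi) ^ Suc k * (2 * pi) ^ Suc k" by (rule power_mult_distrib)
    finally have Xc: "X ^ Suc k * c ^ Suc k = (2 * pi) ^ Suc k * (2 * pi) ^ Suc k" .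
    have "X ^ Suc k / 2 * (s / (2 * pi) ^ Suc k * (c ^ Suc k / 4)) = (X ^ Suc k * c ^ Suc k) * s / (8 * (2 * pi) ^ Suc k)"
      by simp
    also have "\<dots> = s * (2 * pi) ^ (k + 1) / 8"
      unfolding Xc by simp
    finally show ?thesis unfolding K1_def of_real_mult[symmetric] by (simp only:)
  qed
  \<comment> \<open>X^(k+1) contributes 2^(2k+2) to the denominator; the remaining 4 comes from the
    halves in the Bessel integral and in the zeta term of \<open>F\<close>.\<close>
  also have "of_real (X ^ Suc k / 2) * K2 = complex_of_real (s * a ^ (2 * k + 2) * fact k / (2 ^ (2 * k + 4) * (2 * pi) ^ (k + 1))) * of_real (Z * x ^ (k + 1))"
  proof -
    have "X ^ Suc k = a ^ (2 * k + 2) * x ^ (k + 1) / 2 ^ (2 * k + 2)"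
    proof -
      have "2 * k + 2 = 2 * Suc k" by simp
      then show ?thesis unfolding X_def power_divide power_mult_distrib by (simp only: power_mult) simp
    qed
    moreover have "(2 :: real) ^ (2 * k + 4) = 2 ^ (2 * k + 2) * 4" by (simp add: power_add)
    ultimately have "X ^ Suc k / 2 * (s / (2 * pi) ^ Suc k * (fact k * Z / 2)) = s * a ^ (2 * k + 2) * fact k / (2 ^ (2 * k + 4) * (2 * pi) ^ (k + 1)) * (Z * x ^ (k + 1))"
      by (simp only: Suc_eq_plus1) (simp only: times_divide_times_eq times_divide_eq_left times_divide_eq_right divide_divide_eq_left mult_ac)
    then show ?thesis unfolding K2_def of_real_mult[symmetric] by (simp only:)
  qed
  finally have main: "complex_of_real X powr (\<nu> / 2 + of_nat k + 1) *
      (\<Sum>n. of_nat (Suc n) powr (\<nu> / 2) * besselK \<nu> (2 * sqrt (real (Suc n) * X)) * complex_of_real (A n)) =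
      complex_of_real (s * (2 * pi) ^ (k + 1) / 8) * Gamma z * S
      - complex_of_real (s * a ^ (2 * k + 2) * fact k / (2 ^ (2 * k + 4) * (2 * pi) ^ (k + 1))) * of_real (Z * x ^ (k + 1)) * Gamma \<nu>" .
  have rearrange: "p - q * r * g = - q * g * r + p" for p q r g :: complex
    by (simp add: algebra_simps)
  show ?thesis
    unfolding S
    unfolding sq hurwitz_zeta_diff_nat[OF th(1,2) \<open>even k\<close>] A_def[symmetric] X_def[symmetric] Z_def[symmetric] s_def[symmetric] z_def[symmetric]
    by (rule main[unfolded rearrange])
qed

end
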